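(* Let $(M,h,\nabla)$ be a quasi-statistical manifold with $h$ symmetric or skew-symmetric. On $TM\oplus T^*M$ let $\hat h(X+\alpha,Y+\beta)=-\frac12(\alpha(Y)+\beta(X))$ if $h$ is symmetric and $\hat h(X+\alpha,Y+\beta)=-\frac12(\alpha(Y)-\beta(X))$ if $h$ is skew-symmetric, and let $\hat\nabla_{X+\alpha}(Y+\beta)=\nabla_XY+h(\nabla_X(h^{-1}(\beta)))$. Then the generalized dual quasi-statistical connection $\hat\nabla^*$, defined by $$\hat h(Y+\beta,\hat\nabla^*_{X+\alpha}(Z+\gamma))=X(\hat h(Y+\beta,Z+\gamma))-\hat h(\hat\nabla_{X+\alpha}(Y+\beta),Z+\gamma)$$ for all vector fields $X,Y,Z$ and 1-forms $\alpha,\beta,\gamma$ on $M$, is given by $$\hat\nabla^*_{X+\alpha}(Z+\gamma)=h^{-1}(\nabla_X(h(Z)))+\nabla_X\gamma .$$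
   Context: $\nabla$ is an affine connection on the smooth manifold $M$, possibly with torsion $T^\nabla(X,Y)=\nabla_XY-\nabla_YX-[X,Y]$, acting on 1-forms by $(\nabla_X\beta)(Y)=X(\beta(Y))-\beta(\nabla_XY)$. $h$ is a non-degenerate $(0,2)$-tensor field; $h$ also denotes the isomorphism $TM\to T^*M$, $h(X)=h(X,\cdot)$, with inverse $h^{-1}$. $(M,h,\nabla)$ is a quasi-statistical manifold if $(\nabla_Xh)(Y,Z)-(\nabla_Yh)(X,Z)+h(T^\nabla(X,Y),Z)=0$ for all $X,Y,Z$. *)

theory Defs
  imports "HOL-Analysis.Analysis"
begin

subsection \<open>Smooth manifolds and smooth functions\<close>

text \<open>Continuous differentiability of order \<open>k\<close> and infinite order, meant for open \<open>S\<close>.\<close>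

primrec Ck_on :: "nat \<Rightarrow> 'a::euclidean_space set \<Rightarrow> ('a \<Rightarrow> 'b::real_normed_vector) \<Rightarrow> bool" where
  "Ck_on 0 S f \<longleftrightarrow> continuous_on S f"
| "Ck_on (Suc k) S f \<longleftrightarrow> (\<forall>x\<in>S. f differentiable (at x)) \<and>
     (\<forall>v. Ck_on k S (\<lambda>x. frechet_derivative f (at x) v))"

definition smooth_on :: "'a::euclidean_space set \<Rightarrow> ('a \<Rightarrow> 'b::real_normed_vector) \<Rightarrow> bool" where
  "smooth_on S f \<longleftrightarrow> (\<forall>k. Ck_on k S f)"

text \<open>The manifold is the whole type \<open>'m\<close> with its Hausdorff, second countable topology; its
  smooth structure is given by an atlas, not necessarily maximal. A chart is a pair of a domain
  and a coordinate map, which is irrelevant outside the domain.\<close>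

type_synonym ('m, 'e) atlas = "('m set \<times> ('m \<Rightarrow> 'e)) set"

locale smooth_manifold =
  fixes A :: "('m::{t2_space, second_countable_topology}, 'e::euclidean_space) atlas"
  assumes open_domain: "(U, \<phi>) \<in> A \<Longrightarrow> open U"
    and open_range: "(U, \<phi>) \<in> A \<Longrightarrow> open (\<phi> ` U)"
    and homeo: "(U, \<phi>) \<in> A \<Longrightarrow> homeomorphism U (\<phi> ` U) \<phi> (inv_into U \<phi>)"
    and covers: "\<exists>U \<phi>. (U, \<phi>) \<in> A \<and> p \<in> U"
    and compatible: "(U, \<phi>) \<in> A \<Longrightarrow> (V, \<psi>) \<in> A \<Longrightarrow>
      smooth_on (\<phi> ` (U \<inter> V)) (\<psi> \<circ> inv_into U \<phi>)"

definition smooth_fun :: "('m::topological_space, 'e::euclidean_space) atlas \<Rightarrow> ('m \<Rightarrow> real) set" where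
  "smooth_fun A = {f. \<forall>(U, \<phi>)\<in>A. smooth_on (\<phi> ` U) (f \<circ> inv_into U \<phi>)}"


subsection \<open>Tangent vectors, vector fields, 1-forms\<close>

text \<open>Tangent vectors at \<open>p\<close> are the derivations at \<open>p\<close> of the algebra of smooth functions.
  Maps on a subset of a type (here smooth functions, below tangent spaces) are totalised by \<open>0\<close>, so
  that they are determined by their values on that subset.\<close>

type_synonym 'm tvec = "('m \<Rightarrow> real) \<Rightarrow> real"

definition tangent_space :: "('m::topological_space, 'e::euclidean_space) atlas \<Rightarrow> 'm \<Rightarrow> 'm tvec set" where
  "tangent_space A p = {v.
     (\<forall>f\<in>smooth_fun A. \<forall>g\<in>smooth_fun A. v (\<lambda>q. f q + g q) = v f + v g) \<and>
     (\<forall>c. \<forall>f\<in>smooth_fun A. v (\<lambda>q. c * f q) = c * v f) \<and>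
     (\<forall>f\<in>smooth_fun A. \<forall>g\<in>smooth_fun A. v (\<lambda>q. f q * g q) = f p * v g + g p * v f) \<and>
     (\<forall>f. f \<notin> smooth_fun A \<longrightarrow> v f = 0)}"

definition linear_form :: "('m::topological_space, 'e::euclidean_space) atlas \<Rightarrow> 'm \<Rightarrow> ('m tvec \<Rightarrow> real) \<Rightarrow> bool" where
  "linear_form A p \<omega> \<longleftrightarrow>
     (\<forall>v\<in>tangent_space A p. \<forall>w\<in>tangent_space A p. \<omega> (\<lambda>f. v f + w f) = \<omega> v + \<omega> w) \<and>
     (\<forall>c. \<forall>v\<in>tangent_space A p. \<omega> (\<lambda>f. c * v f) = c * \<omega> v)"

definition cotangent_space :: "('m::topological_space, 'e::euclidean_space) atlas \<Rightarrow> 'm \<Rightarrow> ('m tvec \<Rightarrow> real) set" where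
  "cotangent_space A p = {\<omega>. linear_form A p \<omega> \<and> (\<forall>v. v \<notin> tangent_space A p \<longrightarrow> \<omega> v = 0)}"

type_synonym 'm vfield = "'m \<Rightarrow> 'm tvec"
type_synonym 'm form1 = "'m \<Rightarrow> 'm tvec \<Rightarrow> real"

definition deriv_along :: "'m vfield \<Rightarrow> ('m \<Rightarrow> real) \<Rightarrow> 'm \<Rightarrow> real" where
  "deriv_along X f = (\<lambda>p. X p f)"

definition eval_form :: "'m form1 \<Rightarrow> 'm vfield \<Rightarrow> 'm \<Rightarrow> real" where
  "eval_form \<beta> Y = (\<lambda>p. \<beta> p (Y p))"

definition vector_fields :: "('m::topological_space, 'e::euclidean_space) atlas \<Rightarrow> 'm vfield set" where
  "vector_fields A = {X. (\<forall>p. X p \<in> tangent_space A p) \<and>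
     (\<forall>f\<in>smooth_fun A. deriv_along X f \<in> smooth_fun A)}"

definition one_forms :: "('m::topological_space, 'e::euclidean_space) atlas \<Rightarrow> 'm form1 set" where
  "one_forms A = {\<beta>. (\<forall>p. \<beta> p \<in> cotangent_space A p) \<and>
     (\<forall>Y\<in>vector_fields A. eval_form \<beta> Y \<in> smooth_fun A)}"

text \<open>Pointwise operations on vector fields (\<open>'b\<close> the type of functions) and on 1-forms (\<open>'b\<close> the
  type of tangent vectors).\<close>

definition sec_add :: "('m \<Rightarrow> 'b \<Rightarrow> real) \<Rightarrow> ('m \<Rightarrow> 'b \<Rightarrow> real) \<Rightarrow> 'm \<Rightarrow> 'b \<Rightarrow> real" where
  "sec_add s t = (\<lambda>p x. s p x + t p x)"

definition sec_diff :: "('m \<Rightarrow> 'b \<Rightarrow> real) \<Rightarrow> ('m \<Rightarrow> 'b \<Rightarrow> real) \<Rightarrow> 'm \<Rightarrow> 'b \<Rightarrow> real" where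
  "sec_diff s t = (\<lambda>p x. s p x - t p x)"

definition sec_scale :: "('m \<Rightarrow> real) \<Rightarrow> ('m \<Rightarrow> 'b \<Rightarrow> real) \<Rightarrow> 'm \<Rightarrow> 'b \<Rightarrow> real" where
  "sec_scale f s = (\<lambda>p x. f p * s p x)"

definition lie_bracket :: "'m vfield \<Rightarrow> 'm vfield \<Rightarrow> 'm vfield" where
  "lie_bracket X Y = (\<lambda>p f. X p (deriv_along Y f) - Y p (deriv_along X f))"


subsection \<open>(0,2)-tensor fields\<close>

type_synonym 'm tensor02 = "'m \<Rightarrow> 'm tvec \<Rightarrow> 'm tvec \<Rightarrow> real"

definition eval_tensor :: "'m tensor02 \<Rightarrow> 'm vfield \<Rightarrow> 'm vfield \<Rightarrow> 'm \<Rightarrow> real" where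
  "eval_tensor h X Y = (\<lambda>p. h p (X p) (Y p))"

definition tensor_fields02 :: "('m::topological_space, 'e::euclidean_space) atlas \<Rightarrow> 'm tensor02 set" where
  "tensor_fields02 A = {h.
     (\<forall>p. (\<forall>v\<in>tangent_space A p. linear_form A p (\<lambda>w. h p v w)) \<and>
          (\<forall>w\<in>tangent_space A p. linear_form A p (\<lambda>v. h p v w)) \<and>
          (\<forall>v w. v \<notin> tangent_space A p \<or> w \<notin> tangent_space A p \<longrightarrow> h p v w = 0)) \<and>
     (\<forall>X\<in>vector_fields A. \<forall>Y\<in>vector_fields A. eval_tensor h X Y \<in> smooth_fun A)}"

definition nondegenerate :: "('m::topological_space, 'e::euclidean_space) atlas \<Rightarrow> 'm tensor02 \<Rightarrow> bool" where
  "nondegenerate A h \<longleftrightarrow>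
     (\<forall>p. \<forall>v\<in>tangent_space A p. (\<forall>w\<in>tangent_space A p. h p v w = 0) \<longrightarrow> v = (\<lambda>f. 0))"

definition symmetric02 :: "('m::topological_space, 'e::euclidean_space) atlas \<Rightarrow> 'm tensor02 \<Rightarrow> bool" where
  "symmetric02 A h \<longleftrightarrow>
     (\<forall>p. \<forall>v\<in>tangent_space A p. \<forall>w\<in>tangent_space A p. h p v w = h p w v)"

definition skew02 :: "('m::topological_space, 'e::euclidean_space) atlas \<Rightarrow> 'm tensor02 \<Rightarrow> bool" where
  "skew02 A h \<longleftrightarrow>
     (\<forall>p. \<forall>v\<in>tangent_space A p. \<forall>w\<in>tangent_space A p. h p v w = - h p w v)"

text \<open>The bundle map \<open>h : TM \<rightarrow> T\<^sup>*M\<close> and its fibrewise inverse, acting on sections.\<close>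

definition flat :: "'m tensor02 \<Rightarrow> 'm vfield \<Rightarrow> 'm form1" where
  "flat h X = (\<lambda>p. h p (X p))"

definition sharp :: "('m::topological_space, 'e::euclidean_space) atlas \<Rightarrow> 'm tensor02 \<Rightarrow> 'm form1 \<Rightarrow> 'm vfield" where
  "sharp A h \<beta> = (\<lambda>p. inv_into (tangent_space A p) (h p) (\<beta> p))"


subsection \<open>Affine connections and quasi-statistical manifolds\<close>

type_synonym 'm connection = "'m vfield \<Rightarrow> 'm vfield \<Rightarrow> 'm vfield"

definition affine_connection :: "('m::topological_space, 'e::euclidean_space) atlas \<Rightarrow> 'm connection \<Rightarrow> bool" where
  "affine_connection A D \<longleftrightarrow>
     (\<forall>X\<in>vector_fields A. \<forall>Y\<in>vector_fields A. D X Y \<in> vector_fields A) \<and>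
     (\<forall>X\<in>vector_fields A. \<forall>X'\<in>vector_fields A. \<forall>Y\<in>vector_fields A.
        D (sec_add X X') Y = sec_add (D X Y) (D X' Y)) \<and>
     (\<forall>f\<in>smooth_fun A. \<forall>X\<in>vector_fields A. \<forall>Y\<in>vector_fields A.
        D (sec_scale f X) Y = sec_scale f (D X Y)) \<and>
     (\<forall>X\<in>vector_fields A. \<forall>Y\<in>vector_fields A. \<forall>Y'\<in>vector_fields A.
        D X (sec_add Y Y') = sec_add (D X Y) (D X Y')) \<and>
     (\<forall>f\<in>smooth_fun A. \<forall>X\<in>vector_fields A. \<forall>Y\<in>vector_fields A.
        D X (sec_scale f Y) = sec_add (sec_scale (deriv_along X f) Y) (sec_scale f (D X Y)))"

definition torsion :: "'m connection \<Rightarrow> 'm vfield \<Rightarrow> 'm vfield \<Rightarrow> 'm vfield" where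
  "torsion D X Y = sec_diff (sec_diff (D X Y) (D Y X)) (lie_bracket X Y)"

text \<open>\<open>\<nabla>\<^sub>X\<beta>\<close> is the 1-form whose value on every vector field \<open>Y\<close> is \<open>X(\<beta>(Y)) - \<beta>(\<nabla>\<^sub>XY)\<close>.\<close>

definition cov_form :: "('m::topological_space, 'e::euclidean_space) atlas \<Rightarrow> 'm connection \<Rightarrow>
    'm vfield \<Rightarrow> 'm form1 \<Rightarrow> 'm form1" where
  "cov_form A D X \<beta> = (THE \<gamma>. \<gamma> \<in> one_forms A \<and> (\<forall>Y\<in>vector_fields A. \<forall>p.
     eval_form \<gamma> Y p = deriv_along X (eval_form \<beta> Y) p - eval_form \<beta> (D X Y) p))"

text \<open>\<open>(\<nabla>\<^sub>Xh)(Y, Z)\<close>\<close>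

definition cov_tensor :: "'m connection \<Rightarrow> 'm tensor02 \<Rightarrow> 'm vfield \<Rightarrow> 'm vfield \<Rightarrow> 'm vfield \<Rightarrow> 'm \<Rightarrow> real" where
  "cov_tensor D h X Y Z = (\<lambda>p. deriv_along X (eval_tensor h Y Z) p
     - eval_tensor h (D X Y) Z p - eval_tensor h Y (D X Z) p)"

definition quasi_statistical :: "('m::{t2_space, second_countable_topology}, 'e::euclidean_space) atlas \<Rightarrow>
    'm tensor02 \<Rightarrow> 'm connection \<Rightarrow> bool" where
  "quasi_statistical A h D \<longleftrightarrow>
     smooth_manifold A \<and> h \<in> tensor_fields02 A \<and> nondegenerate A h \<and> affine_connection A D \<and>
     (\<forall>X\<in>vector_fields A. \<forall>Y\<in>vector_fields A. \<forall>Z\<in>vector_fields A. \<forall>p.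
        cov_tensor D h X Y Z p - cov_tensor D h Y X Z p + eval_tensor h (torsion D X Y) Z p = 0)"


subsection \<open>The generalized tangent bundle\<close>

text \<open>A section \<open>X + \<alpha>\<close> of \<open>TM \<oplus> T\<^sup>*M\<close> is the pair \<open>(X, \<alpha>)\<close>.\<close>

type_synonym 'm gsec = "'m vfield \<times> 'm form1"

definition gen_sections :: "('m::topological_space, 'e::euclidean_space) atlas \<Rightarrow> 'm gsec set" where
  "gen_sections A = vector_fields A \<times> one_forms A"

text \<open>The second branch is the skew-symmetric case; the two cases exclude each other for
  nondegenerate \<open>h\<close> in positive dimension.\<close>

definition hat_h :: "('m::topological_space, 'e::euclidean_space) atlas \<Rightarrow> 'm tensor02 \<Rightarrow>
    'm gsec \<Rightarrow> 'm gsec \<Rightarrow> 'm \<Rightarrow> real" where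
  "hat_h A h = (\<lambda>(X, \<alpha>) (Y, \<beta>) p.
     if symmetric02 A h then - (1 / 2) * (eval_form \<alpha> Y p + eval_form \<beta> X p)
     else - (1 / 2) * (eval_form \<alpha> Y p - eval_form \<beta> X p))"

definition hat_nabla :: "('m::topological_space, 'e::euclidean_space) atlas \<Rightarrow> 'm tensor02 \<Rightarrow>
    'm connection \<Rightarrow> 'm gsec \<Rightarrow> 'm gsec \<Rightarrow> 'm gsec" where
  "hat_nabla A h D = (\<lambda>(X, \<alpha>) (Y, \<beta>). (D X Y, flat h (D X (sharp A h \<beta>))))"

text \<open>\<open>Ds\<close> is an operation on sections satisfying the defining identity of the generalized dual
  quasi-statistical connection.\<close>

definition is_gen_dual :: "('m::topological_space, 'e::euclidean_space) atlas \<Rightarrow> 'm tensor02 \<Rightarrow>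
    'm connection \<Rightarrow> ('m gsec \<Rightarrow> 'm gsec \<Rightarrow> 'm gsec) \<Rightarrow> bool" where
  "is_gen_dual A h D Ds \<longleftrightarrow>
     (\<forall>\<sigma>\<in>gen_sections A. \<forall>\<tau>\<in>gen_sections A. Ds \<sigma> \<tau> \<in> gen_sections A) \<and>
     (\<forall>X\<in>vector_fields A. \<forall>Y\<in>vector_fields A. \<forall>Z\<in>vector_fields A.
      \<forall>\<alpha>\<in>one_forms A. \<forall>\<beta>\<in>one_forms A. \<forall>\<gamma>\<in>one_forms A. \<forall>p.
        hat_h A h (Y, \<beta>) (Ds (X, \<alpha>) (Z, \<gamma>)) p =
          deriv_along X (hat_h A h (Y, \<beta>) (Z, \<gamma>)) p
          - hat_h A h (hat_nabla A h D (X, \<alpha>) (Y, \<beta>)) (Z, \<gamma>) p)"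

end

theory Submission
  imports Defs
begin

text \<open>The formula satisfies the defining identity because, writing \<open>\<beta> = h(B)\<close>, the (skew-)symmetry of
  \<open>h\<close> turns \<open>\<beta>(h\<^sup>-\<^sup>1(\<nabla>\<^sub>X(h(Z))))\<close> into \<open>X(\<beta>(Z)) - h(\<nabla>\<^sub>XB, Z)\<close>; it is the only solution because the
  pairing \<open>hat_h\<close> is nondegenerate on sections. What takes work is that both sides are sections at all:
  that \<open>\<nabla>\<^sub>X\<gamma>\<close> is a pointwise 1-form and that \<open>h\<^sup>-\<^sup>1\<close> exists and preserves smoothness. Both are read off
  from bump-function extensions of local coordinate frames, which by Hadamard's lemma span the
  derivations, together with Cramer's rule.\<close>

subsection \<open>Calculus of smooth functions\<close>

text \<open>Tangent vectors are derivations of the algebra of globally smooth functions, so they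
  cannot be applied to a coordinate function or a Hadamard coefficient that lives on one chart only.
  Everything local is first multiplied by a cutoff and extended by zero, and Hausdorffness makes the
  extension smooth. For the same reason it is a theorem that coordinate derivations span a tangent
  space; finite dimension, and with it the step from injectivity of h to bijectivity, is available
  only afterwards. Frames serve two more purposes. \<open>cov_form\<close> is a definite
  description, so nothing is known about it until a pointwise form with the prescribed values on
  fields has been built; and uniqueness needs a global field through every tangent vector. The two
  symmetry cases are handled together by a sign s with h(V,W) = s h(W,V) and s * s = 1.\<close>

lemma Ck_on_cong:
  assumes "open S" "Ck_on k S f" "\<And>x. x \<in> S \<Longrightarrow> f x = g x"
  shows "Ck_on k S g"
  using assms(2,3)
proof (induction k arbitrary: f g)
  case 0
  then show ?case using continuous_on_eq by auto
next
  case (Suc k)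
  have "frechet_derivative f (at x) = frechet_derivative g (at x)" "g differentiable (at x)" if "x \<in> S" for x
  proof -
    have d: "f differentiable (at x)" using Suc.prems that by simp
    show "frechet_derivative f (at x) = frechet_derivative g (at x)"
      using frechet_derivative_transform_within_open[OF d \<open>open S\<close> that Suc.prems(2)] .
    show "g differentiable (at x)"
      using d Suc.prems(2) has_derivative_transform_within_open[OF _ \<open>open S\<close> that]
      unfolding differentiable_def by blast
  qed
  then show ?case
    using Suc.prems(1) Suc.IH[of "\<lambda>x. frechet_derivative f (at x) _"] by simp
qed

text \<open>Allows any explicit formula for the derivative in place of
  \<open>frechet_derivative\<close>. The closure properties below are inductions on k through this
  rule: the formula is built from functions already known to be of class k.\<close>

lemma Ck_on_has_derivativeI:
  assumes "open S" "\<And>x. x \<in> S \<Longrightarrow> (f has_derivative F x) (at x)" "\<And>v. Ck_on k S (\<lambda>x. F x v)"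
  shows "Ck_on (Suc k) S f"
proof -
  have "F x = frechet_derivative f (at x)" if "x \<in> S" for x
    using frechet_derivative_at[OF assms(2)[OF that]] .
  then have "Ck_on k S (\<lambda>x. frechet_derivative f (at x) v)" for v
    using Ck_on_cong[OF assms(1) assms(3)[of v]] by simp
  then show ?thesis
    using assms(2) by (auto simp: differentiable_def)
qed

lemma Ck_on_SucD:
  assumes "Ck_on (Suc k) S f"
  shows "x \<in> S \<Longrightarrow> (f has_derivative frechet_derivative f (at x)) (at x)"
    and "Ck_on k S (\<lambda>x. frechet_derivative f (at x) v)"
  using assms by (auto simp: frechet_derivative_works)

lemma Ck_on_subset: "Ck_on k S f \<Longrightarrow> T \<subseteq> S \<Longrightarrow> Ck_on k T f"
  by (induction k arbitrary: f) (auto intro: continuous_on_subset)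

lemma Ck_on_Suc_imp: "Ck_on (Suc k) S f \<Longrightarrow> Ck_on k S f"
proof (induction k arbitrary: f)
  case 0
  then show ?case
    by (auto intro!: continuous_at_imp_continuous_on differentiable_imp_continuous_within)
next
  case (Suc k)
  then show ?case by (metis Ck_on.simps(2))
qed

lemma Ck_on_imp_continuous_on: "Ck_on k S f \<Longrightarrow> continuous_on S f"
  by (induction k) (auto dest: Ck_on_Suc_imp simp del: Ck_on.simps(2))

text \<open>Both continuity and derivatives at a point depend only on a neighbourhood. This is what
  later allows gluing, where a function has different formulas on different patches.\<close>

lemma Ck_on_local:
  assumes "\<And>x. x \<in> S \<Longrightarrow> \<exists>T. open T \<and> x \<in> T \<and> Ck_on k T f"
  shows "Ck_on k S f"
  using assms
proof (induction k arbitrary: f)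
  case 0
  then show ?case
    by (auto intro!: continuous_at_imp_continuous_on simp: continuous_on_eq_continuous_at)
      (metis continuous_on_eq_continuous_at)
next
  case (Suc k)
  have "f differentiable (at x)" if "x \<in> S" for x using Suc.prems[OF that] by auto
  moreover have "Ck_on k S (\<lambda>x. frechet_derivative f (at x) v)" for v
    by (rule Suc.IH) (metis Suc.prems Ck_on.simps(2))
  ultimately show ?case by simp
qed

lemma Ck_on_const: "open S \<Longrightarrow> Ck_on k S (\<lambda>x. c)"
proof (induction k arbitrary: c)
  case (Suc k)
  show ?case
    by (rule Ck_on_has_derivativeI[OF Suc.prems has_derivative_const]) (rule Suc.IH[OF Suc.prems])
qed simp

lemma Ck_on_bounded_linear:
  assumes "open S" "bounded_linear f" shows "Ck_on k S f"
proof (cases k)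
  case 0
  then show ?thesis using assms linear_continuous_on by auto
next
  case (Suc n)
  then show ?thesis
    using Ck_on_has_derivativeI[OF assms(1) bounded_linear_imp_has_derivative[OF assms(2)] Ck_on_const[OF assms(1)]]
    by simp
qed

lemma Ck_on_bounded_linear_comp:
  assumes "open S" "bounded_linear L" "Ck_on k S f" shows "Ck_on k S (\<lambda>x. L (f x))"
  using assms(3)
proof (induction k arbitrary: f)
  case 0
  then show ?case using bounded_linear.continuous_on[OF assms(2)] by auto
next
  case (Suc k)
  show ?case
    by (rule Ck_on_has_derivativeI[OF assms(1) bounded_linear.has_derivative[OF assms(2) Ck_on_SucD(1)[OF Suc.prems]]])
      (use Suc.IH Ck_on_SucD(2)[OF Suc.prems] in auto)
qed

lemma Ck_on_add:
  assumes "open S" "Ck_on k S f" "Ck_on k S g" shows "Ck_on k S (\<lambda>x. f x + g x)"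
  using assms(2,3)
proof (induction k arbitrary: f g)
  case 0
  then show ?case by (auto intro: continuous_intros)
next
  case (Suc k)
  show ?case
    by (rule Ck_on_has_derivativeI[OF assms(1)
          has_derivative_add[OF Ck_on_SucD(1)[OF Suc.prems(1)] Ck_on_SucD(1)[OF Suc.prems(2)]]])
      (use Suc.IH Ck_on_SucD(2)[OF Suc.prems(1)] Ck_on_SucD(2)[OF Suc.prems(2)] in auto)
qed

lemma Ck_on_mult:
  fixes f g :: "'a::euclidean_space \<Rightarrow> real"
  assumes "open S" "Ck_on k S f" "Ck_on k S g" shows "Ck_on k S (\<lambda>x. f x * g x)"
  using assms(2,3)
proof (induction k arbitrary: f g)
  case 0
  then show ?case by (auto intro: continuous_intros)
next
  case (Suc k)
  show ?case
    by (rule Ck_on_has_derivativeI[OF assms(1)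
          has_derivative_mult[OF Ck_on_SucD(1)[OF Suc.prems(1)] Ck_on_SucD(1)[OF Suc.prems(2)]]])
      (assumption, assumption, intro Ck_on_add assms(1) Suc.IH Ck_on_SucD(2)[OF Suc.prems(1)] Ck_on_SucD(2)[OF Suc.prems(2)]
        Ck_on_Suc_imp[OF Suc.prems(1)] Ck_on_Suc_imp[OF Suc.prems(2)])
qed

lemma Ck_on_sum:
  assumes "open S" "finite I" "\<And>i. i \<in> I \<Longrightarrow> Ck_on k S (f i)"
  shows "Ck_on k S (\<lambda>x. \<Sum>i\<in>I. f i x)"
  using assms(2,3) by (induction I rule: finite_induct) (auto simp: Ck_on_const Ck_on_add assms(1))

lemma linear_eq_sum_Basis:
  fixes f :: "'a::euclidean_space \<Rightarrow> real"
  assumes "linear f" shows "f w = (\<Sum>b\<in>Basis. (w \<bullet> b) * f b)"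
proof -
  have "f (\<Sum>b\<in>Basis. (w \<bullet> b) *\<^sub>R b) = (\<Sum>b\<in>Basis. (w \<bullet> b) * f b)"
    by (simp only: linear_sum[OF assms] linear_cmul[OF assms] real_scaleR_def)
  then show ?thesis by (simp only: euclidean_representation)
qed

text \<open>In the chain rule the direction fed to the derivative of \<open>f\<close> varies with x,
  while the induction hypothesis covers fixed directions only. Expanding that direction in
  \<open>Basis\<close> leaves products of components of the derivative of \<open>g\<close> with
  composites in fixed directions.\<close>

lemma Ck_on_compose:
  fixes f :: "'b::euclidean_space \<Rightarrow> real" and g :: "'a::euclidean_space \<Rightarrow> 'b"
  assumes "open S" "Ck_on k T f" "Ck_on k S g" "g ` S \<subseteq> T"
  shows "Ck_on k S (\<lambda>x. f (g x))"
  using assms(2,3)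
proof (induction k arbitrary: f)
  case 0
  then show ?case using assms(4) by (auto intro: continuous_on_compose2)
next
  case (Suc k)
  have d: "((\<lambda>x. f (g x)) has_derivative
      (\<lambda>v. \<Sum>b\<in>Basis. (frechet_derivative g (at x) v \<bullet> b) * frechet_derivative f (at (g x)) b)) (at x)"
    if "x \<in> S" for x
  proof -
    have f: "(f has_derivative frechet_derivative f (at (g x))) (at (g x))"
      using Ck_on_SucD(1)[OF Suc.prems(1)] assms(4) that by auto
    have g: "(g has_derivative frechet_derivative g (at x)) (at x)"
      using Ck_on_SucD(1)[OF Suc.prems(2) that] .
    have l: "linear (frechet_derivative f (at (g x)))"
      using has_derivative_linear[OF f] .
    have "(\<lambda>v. frechet_derivative f (at (g x)) (frechet_derivative g (at x) v)) =
        (\<lambda>v. \<Sum>b\<in>Basis. (frechet_derivative g (at x) v \<bullet> b) * frechet_derivative f (at (g x)) b)"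
      by (rule ext) (rule linear_eq_sum_Basis[OF l])
    with has_derivative_compose[OF g f] show ?thesis by (simp only:)
  qed
  show ?case
    by (rule Ck_on_has_derivativeI[OF assms(1) d])
      (auto intro!: Ck_on_sum Ck_on_mult Ck_on_bounded_linear_comp[where L="\<lambda>y. y \<bullet> _"]
        bounded_linear_inner_left Suc.IH assms(1) Ck_on_SucD(2)[OF Suc.prems(1)]
        Ck_on_SucD(2)[OF Suc.prems(2)] Ck_on_Suc_imp[OF Suc.prems(2)])
qed

lemma Ck_on_inverse:
  fixes f :: "'a::euclidean_space \<Rightarrow> real"
  assumes "open S" "Ck_on k S f" "\<And>x. x \<in> S \<Longrightarrow> f x \<noteq> 0"
  shows "Ck_on k S (\<lambda>x. inverse (f x))"
  using assms(2)
proof (induction k)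
  case 0
  then show ?case using assms(3) by (auto intro!: continuous_intros)
next
  case (Suc k)
  have i: "Ck_on k S (\<lambda>x. inverse (f x))" using Suc.IH Ck_on_Suc_imp[OF Suc.prems] .
  have d: "((\<lambda>x. inverse (f x)) has_derivative
      (\<lambda>v. (- 1) * (inverse (f x) * frechet_derivative f (at x) v * inverse (f x)))) (at x)" if "x \<in> S" for x
    using Deriv.has_derivative_inverse[OF assms(3)[OF that] Ck_on_SucD(1)[OF Suc.prems that]] by simp
  show ?case
    by (rule Ck_on_has_derivativeI[OF assms(1) d])
      (assumption, intro Ck_on_mult Ck_on_const assms(1) i Ck_on_SucD(2)[OF Suc.prems])
qed

section \<open>Smooth cutoff functions\<close>

text \<open>Carrying the exponent \<open>n\<close> makes the span of the family closed under differentiation.\<close>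

definition flat_exp :: "nat \<Rightarrow> real \<Rightarrow> real" where
  "flat_exp n t = (if t > 0 then inverse t ^ n * exp (- inverse t) else 0)"

lemma flat_exp_has_derivative:
  "(flat_exp n has_derivative (\<lambda>v. v * (- real n * flat_exp (n + 1) t + flat_exp (n + 2) t))) (at t)"
proof -
  have "(flat_exp n has_real_derivative (- real n * flat_exp (n + 1) t + flat_exp (n + 2) t)) (at t)"
  proof (cases t "0 :: real" rule: linorder_cases)
    case less
    have "((\<lambda>t. 0) has_real_derivative 0) (at t)" by simp
    then show ?thesis
      using less has_field_derivative_transform_within_open[of "\<lambda>t. 0" 0 t "{..<0}" "flat_exp n"]
      by (auto simp: flat_exp_def)
  next
    case greater
    have "((\<lambda>t. inverse t ^ n * exp (- inverse t)) has_real_derivative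
        (real n * (- (inverse t ^ Suc (Suc 0)) * inverse t ^ (n - Suc 0))) * exp (- inverse t)
        + (exp (- inverse t) * - (- (inverse t ^ Suc (Suc 0)))) * inverse t ^ n) (at t)"
      using greater by (intro DERIV_mult DERIV_power DERIV_inverse DERIV_fun_exp DERIV_minus) auto
    \<comment> \<open>The power rule yields the truncated exponent n - 1; for n = 0 its coefficient
      is 0, hence the case split.\<close>
    also have "(real n * (- (inverse t ^ Suc (Suc 0)) * inverse t ^ (n - Suc 0))) * exp (- inverse t)
        + (exp (- inverse t) * - (- (inverse t ^ Suc (Suc 0)))) * inverse t ^ n
        = - real n * flat_exp (n + 1) t + flat_exp (n + 2) t"
      using greater by (cases n) (auto simp: flat_exp_def algebra_simps)
    finally have "((\<lambda>t. inverse t ^ n * exp (- inverse t)) has_real_derivative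
        (- real n * flat_exp (n + 1) t + flat_exp (n + 2) t)) (at t)" .
    then show ?thesis
      using greater has_field_derivative_transform_within_open[of _ _ t "{0<..}" "flat_exp n"]
      by (auto simp: flat_exp_def)
  next
    case equal
    \<comment> \<open>The difference quotient at 0 from the right, with u = 1/s: u^(n+1) exp(-u)
      tends to 0 as u tends to infinity.\<close>
    have 1: "((\<lambda>s. inverse s ^ (n + 1) * exp (- inverse s)) \<longlongrightarrow> 0) (at_right (0::real))"
      by (rule filterlim_compose[OF tendsto_power_div_exp_0[of "n+1", unfolded divide_inverse exp_minus[symmetric]]
            filterlim_inverse_at_top_right])
    have "((\<lambda>s. flat_exp n s / s) \<longlongrightarrow> 0) (at_right 0)"
      by (rule Lim_transform_eventually[OF 1]) (auto simp: flat_exp_def eventually_at_right_less field_simps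
          intro!: eventually_at_rightI[of 0 1])
    moreover have "((\<lambda>s. flat_exp n s / s) \<longlongrightarrow> 0) (at_left 0)"
      by (rule tendsto_eventually) (auto simp: flat_exp_def intro!: eventually_at_leftI[of "-1" 0])
    ultimately have "((\<lambda>s. flat_exp n s / s) \<longlongrightarrow> 0) (at 0)"
      using filterlim_split_at by blast
    then show ?thesis using equal by (auto simp: has_field_derivative_iff flat_exp_def)
  qed
  then show ?thesis by (simp add: has_field_derivative_def mult.commute[of _ "_ + _"] mult_commute_abs)
qed

lemma Ck_on_flat_exp: "Ck_on k UNIV (flat_exp n)"
proof (induction k arbitrary: n)
  case 0
  show ?case
    by (auto intro!: continuous_at_imp_continuous_on has_derivative_continuous[OF flat_exp_has_derivative])
next
  case (Suc k)
  show ?case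
    by (rule Ck_on_has_derivativeI[OF open_UNIV flat_exp_has_derivative])
      (intro Ck_on_mult Ck_on_add Ck_on_const open_UNIV Suc.IH)
qed

text \<open>The quotient u / (u + w) works, where u is positive exactly inside radius s and w
  exactly outside radius r: since r < s they have no common zero. The squared distance
  \<open>n\<close> is used because it is a polynomial, hence smooth also at the centre.\<close>

lemma bump_exists:
  fixes a :: "'a::euclidean_space"
  assumes "0 < r" "r < s"
  obtains \<rho> :: "'a \<Rightarrow> real" where "smooth_on UNIV \<rho>"
    "\<And>x. x \<in> cball a r \<Longrightarrow> \<rho> x = 1" "\<And>x. x \<notin> ball a s \<Longrightarrow> \<rho> x = 0"
proof -
  define n where "n = (\<lambda>x. (x - a) \<bullet> (x - a))"
  have n: "n x = (dist a x)\<^sup>2" for x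
    by (simp add: n_def dist_norm dot_square_norm norm_minus_commute)
  have Cn: "Ck_on k UNIV n" for k
  proof -
    have "Ck_on k UNIV (\<lambda>x::'a. \<Sum>b\<in>Basis. (x \<bullet> b + (- a \<bullet> b)) * (x \<bullet> b + (- a \<bullet> b)))"
      by (intro Ck_on_sum Ck_on_mult Ck_on_add Ck_on_const
          Ck_on_bounded_linear[OF _ bounded_linear_inner_left]) auto
    then show ?thesis
      unfolding n_def by (subst euclidean_inner) (simp add: inner_diff_left)
  qed
  define u where "u = (\<lambda>x. flat_exp 0 (s\<^sup>2 + (- 1) * n x))"
  define w where "w = (\<lambda>x. flat_exp 0 (n x + (- (r\<^sup>2))))"
  have Cu: "Ck_on k UNIV u" and Cw: "Ck_on k UNIV w" for k
    unfolding u_def w_def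
    by (rule Ck_on_compose[OF open_UNIV Ck_on_flat_exp];
        (intro Ck_on_add Ck_on_mult Ck_on_const Cn open_UNIV subset_UNIV))+
  have pos: "u x + w x \<noteq> 0" for x
  proof -
    have "r\<^sup>2 < s\<^sup>2" using assms by (simp add: power_strict_mono)
    then have "s\<^sup>2 - n x > 0 \<or> n x - r\<^sup>2 > 0" by linarith
    then have "u x > 0 \<or> w x > 0" by (auto simp: u_def w_def flat_exp_def)
    moreover have "u x \<ge> 0" "w x \<ge> 0" by (auto simp: u_def w_def flat_exp_def)
    ultimately show ?thesis by linarith
  qed
  show ?thesis
  proof
    show "smooth_on UNIV (\<lambda>x. u x * inverse (u x + w x))"
      unfolding smooth_on_def by (intro allI Ck_on_mult Ck_on_inverse Ck_on_add Cu Cw open_UNIV pos)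
    fix x
    show "u x * inverse (u x + w x) = 1" if "x \<in> cball a r"
    proof -
      have "n x \<le> r\<^sup>2" using that assms by (simp add: n power_mono)
      then have "w x = 0" by (simp add: w_def flat_exp_def)
      then show ?thesis using pos[of x] by simp
    qed
    show "u x * inverse (u x + w x) = 0" if "x \<notin> ball a s"
    proof -
      have "n x \<ge> s\<^sup>2" using that assms by (simp add: n power_mono)
      then show ?thesis by (simp add: u_def flat_exp_def)
    qed
  qed
qed

section \<open>Hadamard's lemma with smooth coefficients\<close>

lemma continuous_on_segment:
  fixes H :: "'a::real_normed_vector \<Rightarrow> 'b::topological_space"
  assumes "continuous_on S H" "continuous_on T t" "continuous_on T y"
    "\<And>z. z \<in> T \<Longrightarrow> b + t z *\<^sub>R (y z - b) \<in> S"
  shows "continuous_on T (\<lambda>z. H (b + t z *\<^sub>R (y z - b)))"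
proof (rule continuous_on_compose2[OF assms(1)])
  show "continuous_on T (\<lambda>z. b + t z *\<^sub>R (y z - b))"
    by (intro continuous_intros assms(2,3))
qed (use assms(4) in blast)

text \<open>Each differentiation under the integral sign produces one more factor \<open>t\<close>.\<close>

lemma Ck_on_segment_integral:
  fixes H :: "'a::euclidean_space \<Rightarrow> real"
  assumes "open S" "convex S" "b \<in> S" "Ck_on k S H"
  shows "Ck_on k S (\<lambda>x. integral {0..1} (\<lambda>t. t ^ m * H (b + t *\<^sub>R (x - b))))"
  using assms(4)
proof (induction k arbitrary: H m)
  case 0
  have seg: "b + t *\<^sub>R (x - b) \<in> S" if "x \<in> S" "t \<in> {0..1}" for x t
    using convexD_alt[OF assms(2,3) that(1), of t] that(2) by (simp add: algebra_simps)
  have "continuous_on (S \<times> cbox 0 1) (\<lambda>(x, t). t ^ m * H (b + t *\<^sub>R (x - b)))"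
    unfolding split_def using 0 seg
    by (intro continuous_intros continuous_on_segment[of S H]) auto
  then show ?case
    using integral_continuous_on_param[of S 0 1 "\<lambda>x t. t ^ m * H (b + t *\<^sub>R (x - b))"] by simp
next
  case (Suc k)
  have seg: "b + t *\<^sub>R (x - b) \<in> S" if "x \<in> S" "t \<in> {0..1}" for x t
    using convexD_alt[OF assms(2,3) that(1), of t] that(2) by (simp add: algebra_simps)
  \<comment> \<open>Leibniz's rule asks for a jointly continuous family of bounded linear maps;
    their continuity is checked below on basis directions.\<close>
  define F where "F x t = Blinfun (\<lambda>v. t ^ Suc m * frechet_derivative H (at (b + t *\<^sub>R (x - b))) v)" for x t
  have HD: "(H has_derivative frechet_derivative H (at y)) (at y)" if "y \<in> S" for y
    using Ck_on_SucD(1)[OF Suc.prems that] .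
  have F: "blinfun_apply (F x t) = (\<lambda>v. t ^ Suc m * frechet_derivative H (at (b + t *\<^sub>R (x - b))) v)"
    if "x \<in> S" "t \<in> {0..1}" for x t
    unfolding F_def
    by (intro bounded_linear_Blinfun_apply bounded_linear_const_mult has_derivative_bounded_linear[OF HD] seg that)
  have d: "((\<lambda>x. t ^ m * H (b + t *\<^sub>R (x - b))) has_derivative F x t) (at x within S)"
    if "x \<in> S" "t \<in> {0..1}" for x t
  proof -
    have l: "linear (frechet_derivative H (at (b + t *\<^sub>R (x - b))))"
      using has_derivative_linear[OF HD[OF seg[OF that]]] .
    have "((\<lambda>x. b + t *\<^sub>R (x - b)) has_derivative (\<lambda>v. t *\<^sub>R v)) (at x within S)"
      by (auto intro!: derivative_eq_intros)
    from has_derivative_mult_right[OF has_derivative_compose[OF this HD[OF seg[OF that]]], of "t ^ m"]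
    show ?thesis
      unfolding F[OF that] by (simp add: linear_cmul[OF l] mult_ac)
  qed
  have cont: "continuous_on (S \<times> cbox 0 1) (\<lambda>(x, t). F x t)"
  proof (rule continuous_on_blinfun_componentwise)
    fix i :: 'a assume "i \<in> Basis"
    have "continuous_on S (\<lambda>y. frechet_derivative H (at y) i)"
      using Ck_on_imp_continuous_on[OF Ck_on_SucD(2)[OF Suc.prems]] .
    then have "continuous_on (S \<times> cbox 0 1)
        (\<lambda>z. snd z ^ Suc m * frechet_derivative H (at (b + snd z *\<^sub>R (fst z - b))) i)"
      using seg by (intro continuous_intros continuous_on_segment[of S "\<lambda>y. frechet_derivative H (at y) i"]) auto
    then show "continuous_on (S \<times> cbox 0 1) (\<lambda>z. blinfun_apply (case z of (x, t) \<Rightarrow> F x t) i)"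
      by (rule continuous_on_eq) (auto simp: F)
  qed
  have int: "(\<lambda>t. t ^ m * H (b + t *\<^sub>R (x - b))) integrable_on cbox 0 1" if "x \<in> S" for x
  proof -
    have "continuous_on S H"
      by (auto intro!: continuous_at_imp_continuous_on has_derivative_continuous[OF HD])
    then show ?thesis
      using seg[OF that] by (intro integrable_continuous continuous_intros continuous_on_segment[of S H]) auto
  qed
  have D: "((\<lambda>x. integral {0..1} (\<lambda>t. t ^ m * H (b + t *\<^sub>R (x - b)))) has_derivative
      (\<lambda>v. integral {0..1} (\<lambda>t. t ^ Suc m * frechet_derivative H (at (b + t *\<^sub>R (x - b))) v))) (at x)"
    if x: "x \<in> S" for x
  proof -
    have D0: "((\<lambda>x. integral (cbox 0 1) (\<lambda>t. t ^ m * H (b + t *\<^sub>R (x - b)))) has_derivative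
      blinfun_apply (integral (cbox 0 1) (F x))) (at x within S)" (is "(_ has_derivative ?L) _")
      by (rule leibniz_rule[OF d int cont x assms(2)]) auto
    have "continuous_on (cbox 0 1) ((\<lambda>(x, t). F x t) \<circ> (\<lambda>t. (x, t)))"
    proof (rule continuous_on_compose)
      show "continuous_on (cbox 0 1) (\<lambda>t::real. (x, t))"
        by (rule continuous_on_Pair[OF continuous_on_const continuous_on_id])
      show "continuous_on ((\<lambda>t. (x, t)) ` cbox 0 1) (\<lambda>(x, t). F x t)"
        by (rule continuous_on_subset[OF cont]) (use x in auto)
    qed
    then have "F x integrable_on cbox 0 1" by (intro integrable_continuous) (simp add: o_def)
    then have "?L v = integral (cbox 0 1) (\<lambda>t. blinfun_apply (F x t) v)" for v
      by (rule blinfun_apply_integral)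
    then have "?L = (\<lambda>v. integral {0..1} (\<lambda>t. t ^ Suc m * frechet_derivative H (at (b + t *\<^sub>R (x - b))) v))"
      using F[OF x] by (intro ext) (auto intro!: integral_cong)
    with D0 show ?thesis
      by (simp only: at_within_open[OF x assms(1)] cbox_interval)
  qed
  show ?case
    using Ck_on_has_derivativeI[OF assms(1) D] Suc.IH[OF Ck_on_SucD(2)[OF Suc.prems], of "Suc m"] by blast
qed

text \<open>F x - F b is the integral over [0,1] of the derivative of t \<mapsto> F(b + t(x - b)).
  Expanding the direction x - b in \<open>Basis\<close> gives the factors, and \<open>G i\<close> is
  the i-th partial derivative averaged over the segment; at x = b the integrand is constant.\<close>

lemma hadamard:
  fixes F :: "'a::euclidean_space \<Rightarrow> real"
  assumes "open S" "convex S" "b \<in> S" "smooth_on S F"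
  obtains G where "\<And>i. smooth_on S (G i)"
    "\<And>x. x \<in> S \<Longrightarrow> F x = F b + (\<Sum>i\<in>Basis. ((x - b) \<bullet> i) * G i x)"
    "\<And>i. G i b = frechet_derivative F (at b) i"
proof -
  have "Ck_on (Suc 0) S F" and C: "Ck_on (Suc k) S F" for k using assms(4) unfolding smooth_on_def by blast+
  note FD = Ck_on_SucD(1)[OF this(1)]
  note FC = Ck_on_SucD(2)[OF C]
  \<comment> \<open>The factor \<open>t ^ 0\<close> matches the family of integrals with m =
    0.\<close>
  define G where "G i x = integral {0..1} (\<lambda>t. t ^ 0 * frechet_derivative F (at (b + t *\<^sub>R (x - b))) i)" for i x
  have seg: "b + t *\<^sub>R (x - b) \<in> S" if "x \<in> S" "t \<in> {0..1}" for x t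
    using convexD_alt[OF assms(2,3) that(1), of t] that(2) by (simp add: algebra_simps)
  show thesis
  proof
    show "smooth_on S (G i)" for i
      unfolding smooth_on_def G_def by (intro allI Ck_on_segment_integral assms FC)
    show "G i b = frechet_derivative F (at b) i" for i
      by (simp add: G_def)
    show "F x = F b + (\<Sum>i\<in>Basis. ((x - b) \<bullet> i) * G i x)" if x: "x \<in> S" for x
    proof -
      have "((\<lambda>t. F (b + t *\<^sub>R (x - b))) has_vector_derivative
          (\<Sum>i\<in>Basis. ((x - b) \<bullet> i) * frechet_derivative F (at (b + t *\<^sub>R (x - b))) i)) (at t within {0..1})"
        if t: "t \<in> {0..1}" for t
      proof -
        have l: "linear (frechet_derivative F (at (b + t *\<^sub>R (x - b))))"
          using has_derivative_linear[OF FD[OF seg[OF x t]]] .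
        have "((\<lambda>t. b + t *\<^sub>R (x - b)) has_derivative (\<lambda>s. s *\<^sub>R (x - b))) (at t within {0..1})"
          by (auto intro!: derivative_eq_intros)
        from has_derivative_compose[OF this FD[OF seg[OF x t]]]
        have "((\<lambda>t. F (b + t *\<^sub>R (x - b))) has_vector_derivative
            frechet_derivative F (at (b + t *\<^sub>R (x - b))) (x - b)) (at t within {0..1})"
          by (simp add: has_vector_derivative_def linear_cmul[OF l])
        moreover have "frechet_derivative F (at (b + t *\<^sub>R (x - b))) (x - b) =
            (\<Sum>i\<in>Basis. ((x - b) \<bullet> i) * frechet_derivative F (at (b + t *\<^sub>R (x - b))) i)"
          by (rule linear_eq_sum_Basis[OF l])
        ultimately show ?thesis by simp
      qed
      from fundamental_theorem_of_calculus[OF _ this]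
      have 1: "((\<lambda>t. \<Sum>i\<in>Basis. ((x - b) \<bullet> i) * frechet_derivative F (at (b + t *\<^sub>R (x - b))) i)
          has_integral F x - F b) {0..1}" by simp
      have "(\<lambda>t. frechet_derivative F (at (b + t *\<^sub>R (x - b))) i) integrable_on {0..1}" for i
      proof -
        have "continuous_on S (\<lambda>y. frechet_derivative F (at y) i)" using FC[of 0] by simp
        then show ?thesis
          using seg[OF x] by (intro integrable_continuous_real continuous_intros
              continuous_on_segment[of S "\<lambda>y. frechet_derivative F (at y) i"]) auto
      qed
      then have "((\<lambda>t. \<Sum>i\<in>Basis. ((x - b) \<bullet> i) * frechet_derivative F (at (b + t *\<^sub>R (x - b))) i)
          has_integral (\<Sum>i\<in>Basis. ((x - b) \<bullet> i) * G i x)) {0..1}"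
        by (intro has_integral_sum has_integral_mult_right) (auto simp: G_def)
      from has_integral_unique[OF 1 this] show ?thesis by simp
    qed
  qed
qed


subsection \<open>Smooth functions and tangent vectors\<close>

lemma tangent_space_add:
  "v \<in> tangent_space A p \<Longrightarrow> f \<in> smooth_fun A \<Longrightarrow> g \<in> smooth_fun A \<Longrightarrow> v (\<lambda>q. f q + g q) = v f + v g"
  and tangent_space_cmult: "v \<in> tangent_space A p \<Longrightarrow> f \<in> smooth_fun A \<Longrightarrow> v (\<lambda>q. c * f q) = c * v f"
  and tangent_space_mult: "v \<in> tangent_space A p \<Longrightarrow> f \<in> smooth_fun A \<Longrightarrow> g \<in> smooth_fun A \<Longrightarrow>
    v (\<lambda>q. f q * g q) = f p * v g + g p * v f"
  and tangent_space_nonsmooth: "v \<in> tangent_space A p \<Longrightarrow> f \<notin> smooth_fun A \<Longrightarrow> v f = 0"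
  unfolding tangent_space_def by blast+

lemma tangent_space_combination:
  assumes "\<And>i. i \<in> I \<Longrightarrow> v i \<in> tangent_space A p"
  shows "(\<lambda>f. \<Sum>i\<in>I. c i * v i f) \<in> tangent_space A p"
proof -
  have "(\<Sum>i\<in>I. c i * v i (\<lambda>q. f q + g q)) = (\<Sum>i\<in>I. c i * v i f) + (\<Sum>i\<in>I. c i * v i g)"
    if "f \<in> smooth_fun A" "g \<in> smooth_fun A" for f g
    using that by (simp add: tangent_space_add[OF assms] algebra_simps sum.distrib)
  moreover have "(\<Sum>i\<in>I. c i * v i (\<lambda>q. d * f q)) = d * (\<Sum>i\<in>I. c i * v i f)" if "f \<in> smooth_fun A" for d f
    using that by (simp add: tangent_space_cmult[OF assms] algebra_simps sum_distrib_left)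
  moreover have "(\<Sum>i\<in>I. c i * v i (\<lambda>q. f q * g q)) = f p * (\<Sum>i\<in>I. c i * v i g) + g p * (\<Sum>i\<in>I. c i * v i f)"
    if "f \<in> smooth_fun A" "g \<in> smooth_fun A" for f g
    using that by (simp add: tangent_space_mult[OF assms] algebra_simps sum_distrib_left sum.distrib)
  ultimately show ?thesis
    using assms unfolding tangent_space_def by (auto intro!: sum.neutral)
qed

text \<open>These are linear combinations over an empty, a one-element and a two-element index set,
  the last being \<open>bool\<close>.\<close>

lemma tangent_space_zero: "(\<lambda>f. 0) \<in> tangent_space A p"
  and tangent_space_scale: "v \<in> tangent_space A p \<Longrightarrow> (\<lambda>f. c * v f) \<in> tangent_space A p"
  and tangent_space_plus:
    "v \<in> tangent_space A p \<Longrightarrow> w \<in> tangent_space A p \<Longrightarrow> (\<lambda>f. v f + w f) \<in> tangent_space A p"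
  using tangent_space_combination[of "{}" "\<lambda>_. v" A p "\<lambda>_. c"]
    tangent_space_combination[of "{True}" "\<lambda>_. v" A p "\<lambda>_. c"]
    tangent_space_combination[of "UNIV" "\<lambda>b. if b then v else w" A p "\<lambda>_. 1"]
  by (auto simp: UNIV_bool add.commute)

lemma smooth_funI:
  "(\<And>U \<phi> k. (U, \<phi>) \<in> A \<Longrightarrow> Ck_on k (\<phi> ` U) (f \<circ> inv_into U \<phi>)) \<Longrightarrow> f \<in> smooth_fun A"
  unfolding smooth_fun_def smooth_on_def by auto

lemma smooth_funD: "f \<in> smooth_fun A \<Longrightarrow> (U, \<phi>) \<in> A \<Longrightarrow> Ck_on k (\<phi> ` U) (f \<circ> inv_into U \<phi>)"
  unfolding smooth_fun_def smooth_on_def by auto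

context smooth_manifold
begin

lemma smooth_fun_const [intro, simp]: "(\<lambda>q. c) \<in> smooth_fun A"
  by (rule smooth_funI) (simp add: o_def Ck_on_const open_range)

lemma smooth_fun_add [intro]:
  "f \<in> smooth_fun A \<Longrightarrow> g \<in> smooth_fun A \<Longrightarrow> (\<lambda>q. f q + g q) \<in> smooth_fun A"
  by (rule smooth_funI) (auto simp: o_def dest: smooth_funD intro!: Ck_on_add open_range)

lemma smooth_fun_mult [intro]:
  "f \<in> smooth_fun A \<Longrightarrow> g \<in> smooth_fun A \<Longrightarrow> (\<lambda>q. f q * g q) \<in> smooth_fun A"
  by (rule smooth_funI) (auto simp: o_def dest: smooth_funD intro!: Ck_on_mult open_range)

lemma smooth_fun_diff [intro]:
  "f \<in> smooth_fun A \<Longrightarrow> g \<in> smooth_fun A \<Longrightarrow> (\<lambda>q. f q - g q) \<in> smooth_fun A"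
  using smooth_fun_add[of f "\<lambda>q. (- 1) * g q"] smooth_fun_mult[of "\<lambda>q. - 1" g] by simp

lemma smooth_fun_sum [intro]:
  "(\<And>i. i \<in> I \<Longrightarrow> f i \<in> smooth_fun A) \<Longrightarrow> (\<lambda>q. \<Sum>i\<in>I. f i q) \<in> smooth_fun A"
  by (induction I rule: infinite_finite_induct) auto

lemma smooth_fun_prod [intro]:
  "(\<And>i. i \<in> I \<Longrightarrow> f i \<in> smooth_fun A) \<Longrightarrow> (\<lambda>q. \<Prod>i\<in>I. f i q) \<in> smooth_fun A"
  by (induction I rule: infinite_finite_induct) auto

lemma tangent_space_sum:
  assumes "v \<in> tangent_space A p" "\<And>i. i \<in> I \<Longrightarrow> f i \<in> smooth_fun A"
  shows "v (\<lambda>q. \<Sum>i\<in>I. f i q) = (\<Sum>i\<in>I. v (f i))"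
  using assms(2)
proof (induction I rule: infinite_finite_induct)
  case (insert i I)
  then show ?case
    using tangent_space_add[OF assms(1), of "f i" "\<lambda>q. \<Sum>i\<in>I. f i q"] by auto
qed (use tangent_space_cmult[OF assms(1) smooth_fun_const, of 0 0] in auto)

lemma tangent_space_diff:
  assumes "v \<in> tangent_space A p" "f \<in> smooth_fun A" "g \<in> smooth_fun A"
  shows "v (\<lambda>q. f q - g q) = v f - v g"
proof -
  have "(\<lambda>q. (- 1) * g q) \<in> smooth_fun A"
    by (intro smooth_fun_mult smooth_fun_const assms(3))
  from tangent_space_add[OF assms(1,2) this] tangent_space_cmult[OF assms(1,3), of "- 1"]
  show ?thesis by simp
qed

section \<open>From functions on charts to global smooth functions\<close>

lemma chart_image_open:
  assumes "(U, \<phi>) \<in> A" "open N" shows "open (\<phi> ` (U \<inter> N))"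
proof -
  have "openin (top_of_set (\<phi> ` U)) (\<phi> ` (U \<inter> N))"
    using homeomorphism_imp_open_map[OF homeo[OF assms(1)], of "U \<inter> N"] assms(2) by auto
  then show ?thesis
    using openin_open_trans open_range[OF assms(1)] by blast
qed

lemma chart_inv: "(U, \<phi>) \<in> A \<Longrightarrow> q \<in> U \<Longrightarrow> inv_into U \<phi> (\<phi> q) = q"
  using homeo homeomorphism_apply1 by blast

text \<open>Tailored to Cramer's rule, whose denominator is globally smooth but known to be nonzero
  only near the point in question.\<close>

lemma smooth_fun_quotient:
  assumes "\<And>p. \<exists>N u d. open N \<and> p \<in> N \<and> u \<in> smooth_fun A \<and> d \<in> smooth_fun A \<and>
    (\<forall>q\<in>N. d q \<noteq> 0 \<and> f q = u q / d q)"
  shows "f \<in> smooth_fun A"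
proof (rule smooth_funI, rule Ck_on_local)
  fix U \<phi> k x assume c: "(U, \<phi>) \<in> A" and "x \<in> \<phi> ` U"
  then obtain p where p: "p \<in> U" "x = \<phi> p" by blast
  from assms[of p] obtain N u d where N: "open N" "p \<in> N" "u \<in> smooth_fun A" "d \<in> smooth_fun A"
    "\<And>q. q \<in> N \<Longrightarrow> d q \<noteq> 0 \<and> f q = u q / d q" by blast
  let ?T = "\<phi> ` (U \<inter> N)" and ?i = "inv_into U \<phi>"
  have T: "open ?T" by (rule chart_image_open[OF c N(1)])
  have "Ck_on k ?T (\<lambda>y. (u \<circ> ?i) y * inverse ((d \<circ> ?i) y))"
    by (intro Ck_on_mult Ck_on_inverse T Ck_on_subset[OF smooth_funD[OF N(3) c]]
        Ck_on_subset[OF smooth_funD[OF N(4) c]]) (auto simp: chart_inv[OF c] N(5))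
  then have "Ck_on k ?T (f \<circ> ?i)"
    by (rule Ck_on_cong[OF T]) (auto simp: chart_inv[OF c] N(5) divide_inverse)
  with T p N(2) show "\<exists>T. open T \<and> x \<in> T \<and> Ck_on k T (f \<circ> ?i)" by blast
qed

text \<open>The copy of K in the manifold is compact, hence closed by the Hausdorff property. So a
  point outside the chart domain has a neighbourhood avoiding it, on which the extension is 0; at
  points of the domain the transition maps do the work.\<close>

lemma smooth_fun_extend_zero:
  assumes c: "(U, \<phi>) \<in> A" and S: "open S" "S \<subseteq> \<phi> ` U" "\<And>k. Ck_on k S F"
    and K: "compact K" "K \<subseteq> S" "\<And>x. x \<in> \<phi> ` U \<Longrightarrow> x \<notin> K \<Longrightarrow> F x = 0"
  shows "(\<lambda>q. if q \<in> U then F (\<phi> q) else 0) \<in> smooth_fun A" (is "?f \<in> _")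
proof -
  \<comment> \<open>S and the complement of K in the chart range are open and cover the range; on
    the second set F is 0.\<close>
  have CF: "Ck_on k (\<phi> ` U) F" for k
  proof (rule Ck_on_local)
    fix x assume x: "x \<in> \<phi> ` U"
    show "\<exists>T. open T \<and> x \<in> T \<and> Ck_on k T F"
    proof (cases "x \<in> K")
      case True
      then show ?thesis using S K by blast
    next
      case False
      let ?T = "\<phi> ` U - K"
      have T: "open ?T" using K(1) open_range[OF c] by (simp add: open_Diff compact_imp_closed)
      have "Ck_on k ?T F" by (rule Ck_on_cong[OF T Ck_on_const[OF T, of k 0]]) (use K in auto)
      then show ?thesis using T x False by blast
    qed
  qed
  define KK where "KK = inv_into U \<phi> ` K"
  have "continuous_on (\<phi> ` U) (inv_into U \<phi>)" using homeo[OF c] unfolding homeomorphism_def by blast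
  then have "continuous_on K (inv_into U \<phi>)" by (rule continuous_on_subset) (use S K in blast)
  then have "compact KK"
    unfolding KK_def using K(1) by (rule compact_continuous_image)
  then have KK: "closed KK" by (rule compact_imp_closed)
  show ?thesis
  proof (rule smooth_funI, rule Ck_on_local)
    fix V \<psi> k x assume d: "(V, \<psi>) \<in> A" and "x \<in> \<psi> ` V"
    then obtain q where q: "q \<in> V" "x = \<psi> q" by blast
    let ?i = "inv_into V \<psi>"
    show "\<exists>T. open T \<and> x \<in> T \<and> Ck_on k T (?f \<circ> ?i)"
    proof (cases "q \<in> U")
      case True
      let ?T = "\<psi> ` (V \<inter> U)"
      have T: "open ?T" by (rule chart_image_open[OF d open_domain[OF c]])
      have "Ck_on k ?T (\<lambda>y. F ((\<phi> \<circ> ?i) y))"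
        by (rule Ck_on_compose[OF T CF]) (use compatible[OF d c] in \<open>auto simp: smooth_on_def chart_inv[OF d] o_def\<close>)
      then have "Ck_on k ?T (?f \<circ> ?i)"
        by (rule Ck_on_cong[OF T]) (auto simp: chart_inv[OF d])
      then show ?thesis using T q True by blast
    next
      case False
      let ?T = "\<psi> ` (V \<inter> - KK)"
      have T: "open ?T" by (rule chart_image_open[OF d]) (use KK in auto)
      have "Ck_on k ?T (?f \<circ> ?i)"
      proof (rule Ck_on_cong[OF T Ck_on_const[OF T, of k 0]])
        fix y assume "y \<in> ?T"
        then obtain z where z: "z \<in> V" "z \<notin> KK" "y = \<psi> z" by blast
        have "F (\<phi> z) = 0" if "z \<in> U"
        proof (rule K(3))
          show "\<phi> z \<notin> K" using z(2) chart_inv[OF c that] unfolding KK_def by force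
        qed (use that in simp)
        then show "0 = (?f \<circ> ?i) y" using z by (simp add: chart_inv[OF d])
      qed
      moreover have "q \<notin> KK"
        using False S(2) K(2) inv_into_into[of _ \<phi> U] unfolding KK_def by blast
      ultimately show ?thesis using T q by blast
    qed
  qed
qed

section \<open>Derivations and local frames\<close>

lemma chart_has_derivative:
  "f \<in> smooth_fun A \<Longrightarrow> (U, \<phi>) \<in> A \<Longrightarrow> q \<in> U \<Longrightarrow>
    ((f \<circ> inv_into U \<phi>) has_derivative frechet_derivative (f \<circ> inv_into U \<phi>) (at (\<phi> q))) (at (\<phi> q))"
  by (rule Ck_on_SucD(1)[OF smooth_funD[where k = "Suc 0"]]) auto

text \<open>The factor \<open>r\<close> will be the value of a cutoff at the point, so that the
  cut-off coordinate fields are covered directly.\<close>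

lemma coordinate_derivation_in_tangent_space:
  assumes c: "(U, \<phi>) \<in> A" and q: "q \<in> U"
  shows "(\<lambda>f. if f \<in> smooth_fun A then r * frechet_derivative (f \<circ> inv_into U \<phi>) (at (\<phi> q)) i else 0)
    \<in> tangent_space A q"
proof -
  note D = chart_has_derivative[OF _ c q]
  let ?D = "\<lambda>f. frechet_derivative (f \<circ> inv_into U \<phi>) (at (\<phi> q))"
  have add: "?D (\<lambda>q. f q + g q) i = ?D f i + ?D g i" if "f \<in> smooth_fun A" "g \<in> smooth_fun A" for f g
    using fun_cong[OF frechet_derivative_at[OF has_derivative_add[OF D[OF that(1)] D[OF that(2)]]], of i]
    by (simp add: o_def)
  have cm: "?D (\<lambda>q. s * f q) i = s * ?D f i" if "f \<in> smooth_fun A" for f s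
    using fun_cong[OF frechet_derivative_at[OF has_derivative_mult_right[OF D[OF that], of s]], of i]
    by (simp add: o_def)
  have mu: "?D (\<lambda>q. f q * g q) i = f q * ?D g i + ?D f i * g q" if "f \<in> smooth_fun A" "g \<in> smooth_fun A" for f g
    using fun_cong[OF frechet_derivative_at[OF has_derivative_mult[OF D[OF that(1)] D[OF that(2)]]], of i]
    by (simp add: o_def chart_inv[OF c q])
  show ?thesis
    unfolding tangent_space_def
    by (auto simp: add cm mu smooth_fun_add smooth_fun_mult algebra_simps)
qed

text \<open>Since \<open>\<xi>\<close> is \<open>1\<close> near \<open>q\<close>, multiplying Hadamard's expansion of \<open>f\<close> by \<open>\<xi>\<^sup>2\<close> gives an identity between
  global smooth functions without changing the value of a derivation at \<open>q\<close>.\<close>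

lemma local_frame:
  obtains W \<psi> E x where "open W" "p \<in> W" "\<psi> \<in> smooth_fun A" "\<psi> p = 1" "\<And>q. q \<notin> W \<Longrightarrow> \<psi> q = 0"
    "\<And>i. E i \<in> vector_fields A" "\<And>i. x i \<in> smooth_fun A"
    "\<And>q v. q \<in> W \<Longrightarrow> v \<in> tangent_space A q \<Longrightarrow> v = (\<lambda>f. \<Sum>i\<in>(Basis :: 'e set). v (x i) * E i q f)"
    "\<And>q i j. q \<in> W \<Longrightarrow> i \<in> Basis \<Longrightarrow> j \<in> Basis \<Longrightarrow> E i q (x j) = (if i = j then 1 else 0)"
proof -
  obtain U \<phi> where c: "(U, \<phi>) \<in> A" and p: "p \<in> U" using covers by blast
  let ?i = "inv_into U \<phi>"
  define a where "a = \<phi> p"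
  obtain R where R: "R > 0" "cball a R \<subseteq> \<phi> ` U"
    using open_range[OF c] p unfolding a_def open_contains_cball by blast
  \<comment> \<open>The radii are nested around that of \<open>W\<close>, which is R/3:
    \<open>\<rho>\<close> is 1 over \<open>W\<close>, so cutting off with it does not disturb
    coordinates there, while \<open>\<eta>\<close> vanishes outside \<open>W\<close> and yields the
    function \<open>\<psi>\<close> of the statement.\<close>
  obtain \<rho> :: "'e \<Rightarrow> real" where \<rho>: "smooth_on UNIV \<rho>"
    "\<And>x. x \<in> cball a (R/3) \<Longrightarrow> \<rho> x = 1" "\<And>x. x \<notin> ball a (R/2) \<Longrightarrow> \<rho> x = 0"
    using bump_exists[of "R/3" "R/2" a] R by auto
  obtain \<eta> :: "'e \<Rightarrow> real" where \<eta>: "smooth_on UNIV \<eta>"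
    "\<And>x. x \<in> cball a (R/6) \<Longrightarrow> \<eta> x = 1" "\<And>x. x \<notin> ball a (R/3) \<Longrightarrow> \<eta> x = 0"
    using bump_exists[of "R/6" "R/3" a] R by auto
  define ext where "ext F = (\<lambda>q. if q \<in> U then F (\<phi> q) else 0)" for F :: "'e \<Rightarrow> real"
  let ?S = "ball a R"
  have SU: "?S \<subseteq> \<phi> ` U" using R(2) ball_subset_cball by blast
  have C\<rho>: "Ck_on k T \<rho>" and C\<eta>: "Ck_on k T \<eta>" for k T
    using \<rho>(1) \<eta>(1) Ck_on_subset unfolding smooth_on_def by blast+
  have ext\<rho>: "ext (\<lambda>x. \<rho> x * F x) \<in> smooth_fun A" if "\<And>k. Ck_on k ?S F" for F
    unfolding ext_def
    by (rule smooth_fun_extend_zero[OF c open_ball SU, of _ "cball a (R/2)"])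
      (use that R C\<rho> \<rho>(3) in \<open>auto intro: Ck_on_mult\<close>)
  have ext\<eta>: "ext \<eta> \<in> smooth_fun A"
    unfolding ext_def
    by (rule smooth_fun_extend_zero[OF c open_ball SU, of _ "cball a (R/3)"])
      (use R C\<eta> \<eta>(3) in auto)
  have CS: "Ck_on k ?S (f \<circ> ?i)" if "f \<in> smooth_fun A" for k f
    using Ck_on_subset[OF smooth_funD[OF that c] SU] .
  define W where "W = {q \<in> U. \<phi> q \<in> ball a (R/3)}"
  define \<xi> where "\<xi> = ext (\<lambda>x. \<rho> x * 1)"
  define x where "x j = ext (\<lambda>y. \<rho> y * (y \<bullet> j))" for j
  define E where "E j q f = (if q \<in> U \<and> f \<in> smooth_fun A
      then \<rho> (\<phi> q) * frechet_derivative (f \<circ> ?i) (at (\<phi> q)) j else 0)" for j q f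
  have \<xi>: "\<xi> \<in> smooth_fun A" unfolding \<xi>_def by (intro ext\<rho> Ck_on_const open_ball)
  have x: "x j \<in> smooth_fun A" for j
    unfolding x_def by (intro ext\<rho> Ck_on_bounded_linear open_ball bounded_linear_inner_left)
  have ET: "E j q \<in> tangent_space A q" for j q
  proof (cases "q \<in> U")
    case True
    then show ?thesis
      using coordinate_derivation_in_tangent_space[OF c True] unfolding E_def by simp
  next
    case False
    then have "E j q = (\<lambda>f. 0)" unfolding E_def by auto
    then show ?thesis using tangent_space_zero by simp
  qed
  have E: "E j \<in> vector_fields A" for j
  proof -
    have "deriv_along (E j) f \<in> smooth_fun A" if f: "f \<in> smooth_fun A" for f
    proof -
      have "deriv_along (E j) f = ext (\<lambda>x. \<rho> x * frechet_derivative (f \<circ> ?i) (at x) j)"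
        using f unfolding deriv_along_def E_def ext_def by auto
      then show ?thesis using ext\<rho>[OF Ck_on_SucD(2)[OF CS[OF f]]] by simp
    qed
    then show ?thesis unfolding vector_fields_def using ET by blast
  qed
  show thesis
  proof
    show "open W"
    proof -
      have "openin (top_of_set U) (U \<inter> \<phi> -` ball a (R/3))"
        using homeo[OF c] by (intro continuous_openin_preimage_gen) (auto simp: homeomorphism_def)
      moreover have "W = U \<inter> \<phi> -` ball a (R/3)" unfolding W_def by auto
      ultimately show ?thesis using openin_open_trans open_domain[OF c] by metis
    qed
    show "p \<in> W" using p R unfolding W_def a_def by simp
    show "ext \<eta> \<in> smooth_fun A" by (rule ext\<eta>)
    show "ext \<eta> p = 1" using p R \<eta>(2)[of a] unfolding ext_def a_def by simp
    show "ext \<eta> q = 0" if "q \<notin> W" for q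
      using that \<eta>(3)[of "\<phi> q"] unfolding ext_def W_def by auto
    show "E i \<in> vector_fields A" "x i \<in> smooth_fun A" for i by (rule E, rule x)
    show "E i q (x j) = (if i = j then 1 else 0)" if q: "q \<in> W" and ij: "i \<in> Basis" "j \<in> Basis" for q i j
    proof -
      have U: "q \<in> U" and b: "\<phi> q \<in> ball a (R/3)" using q unfolding W_def by auto
      have "((\<lambda>y. y \<bullet> j) has_derivative (\<lambda>v. v \<bullet> j)) (at (\<phi> q))"
        by (auto intro!: derivative_eq_intros)
      \<comment> \<open>On the open ball of radius R/3 the cut-off coordinate is the true one, so
        both have the same derivative at \<open>\<phi> q\<close>.\<close>
      moreover have "y \<bullet> j = (x j \<circ> ?i) y" if "y \<in> ball a (R/3)" for y
      proof -
        have "y \<in> \<phi> ` U" using that R by auto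
        then obtain z where "z \<in> U" "y = \<phi> z" by blast
        then show ?thesis using that \<rho>(2)[of y] by (simp add: x_def ext_def chart_inv[OF c])
      qed
      ultimately have "((x j \<circ> ?i) has_derivative (\<lambda>v. v \<bullet> j)) (at (\<phi> q))"
        using has_derivative_transform_within_open[OF _ open_ball b] by blast
      then have "frechet_derivative (x j \<circ> ?i) (at (\<phi> q)) i = i \<bullet> j"
        using frechet_derivative_at by metis
      then show ?thesis
        using U x b \<rho>(2)[of "\<phi> q"] inner_Basis[OF ij] unfolding E_def by simp
    qed
    show "v = (\<lambda>f. \<Sum>i\<in>(Basis :: 'e set). v (x i) * E i q f)"
      if q: "q \<in> W" and v: "v \<in> tangent_space A q" for q v
    proof
      fix f
      have U: "q \<in> U" and b: "\<phi> q \<in> ball a (R/3)" using q unfolding W_def by auto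
      have bS: "\<phi> q \<in> ?S" using b R by auto
      have \<rho>b: "\<rho> (\<phi> q) = 1" using b \<rho>(2) by simp
      show "v f = (\<Sum>i\<in>(Basis :: 'e set). v (x i) * E i q f)"
      proof (cases "f \<in> smooth_fun A")
        case False
        then show ?thesis using tangent_space_nonsmooth[OF v] by (simp add: E_def)
      next
        case f: True
        have "smooth_on ?S (f \<circ> ?i)" using CS[OF f] unfolding smooth_on_def by blast
        from hadamard[OF open_ball convex_ball bS this] obtain G where G: "\<And>i. smooth_on ?S (G i)"
          "\<And>y. y \<in> ?S \<Longrightarrow> (f \<circ> ?i) y = (f \<circ> ?i) (\<phi> q) + (\<Sum>i\<in>Basis. ((y - \<phi> q) \<bullet> i) * G i y)"
          "\<And>i. G i (\<phi> q) = frechet_derivative (f \<circ> ?i) (at (\<phi> q)) i" by blast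
        define g where "g j = ext (\<lambda>y. \<rho> y * G j y)" for j
        have g: "g j \<in> smooth_fun A" for j
          unfolding g_def by (rule ext\<rho>) (use G(1) in \<open>auto simp: smooth_on_def\<close>)
        \<comment> \<open>A global substitute for the shifted coordinate that vanishes at q: inside
          the chart it is \<open>\<rho>\<close> times the j-th component of y -
          \<open>\<phi> q\<close>.\<close>
        define w where "w j = (\<lambda>z. x j z - (\<phi> q \<bullet> j) * \<xi> z)" for j
        have w: "w j \<in> smooth_fun A" for j
          unfolding w_def by (intro smooth_fun_diff smooth_fun_mult smooth_fun_const x \<xi>)
        have \<xi>1: "\<xi> q = 1" using U \<rho>b by (simp add: \<xi>_def ext_def)
        \<comment> \<open>A derivation kills a function equal to 1 near q: with
          \<open>\<theta>\<close> supported where \<open>\<xi>\<close> is 1 and equal to 1 at q, the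
          product \<xi>\<theta> is \<theta>, and the Leibniz rule turns this into v \<theta> = v
          \<theta> + v \<xi>.\<close>
        have v\<xi>: "v \<xi> = 0"
        proof -
          obtain \<theta> :: "'e \<Rightarrow> real" where \<theta>: "smooth_on UNIV \<theta>" "\<theta> (\<phi> q) = 1"
            "\<And>y. y \<notin> ball a (R/3) \<Longrightarrow> \<theta> y = 0"
          proof -
            have d: "dist a (\<phi> q) < R/3" using b by simp
            \<comment> \<open>The inner radius must reach \<open>\<phi> q\<close>; the maximum with
              R/6 keeps it positive when \<open>\<phi> q\<close> is the centre.\<close>
            obtain \<theta> :: "'e \<Rightarrow> real" where "smooth_on UNIV \<theta>"
              "\<And>x. x \<in> cball a (max (dist a (\<phi> q)) (R/6)) \<Longrightarrow> \<theta> x = 1" "\<And>x. x \<notin> ball a (R/3) \<Longrightarrow> \<theta> x = 0"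
              by (rule bump_exists[of "max (dist a (\<phi> q)) (R/6)" "R/3" a]) (use R d in auto)
            then show ?thesis using that by auto
          qed
          have e: "ext \<theta> \<in> smooth_fun A"
            unfolding ext_def
            by (rule smooth_fun_extend_zero[OF c open_ball SU, of _ "cball a (R/3)"])
              (use R \<theta> in \<open>auto simp: smooth_on_def intro: Ck_on_subset[of _ UNIV]\<close>)
          have "(\<lambda>z. \<xi> z * ext \<theta> z) = ext \<theta>"
          proof
            fix z show "\<xi> z * ext \<theta> z = ext \<theta> z"
              using \<theta>(3)[of "\<phi> z"] \<rho>(2)[of "\<phi> z"] unfolding \<xi>_def ext_def by force
          qed
          moreover have "ext \<theta> q = 1" using U \<theta>(2) by (simp add: ext_def)
          ultimately show ?thesis using tangent_space_mult[OF v \<xi> e] \<xi>1 by simp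
        qed
        have \<xi>\<xi>: "(\<lambda>z. \<xi> z * \<xi> z) \<in> smooth_fun A" by (intro smooth_fun_mult \<xi>)
        have v\<xi>\<xi>: "v (\<lambda>z. \<xi> z * \<xi> z) = 0" using tangent_space_mult[OF v \<xi> \<xi>] v\<xi> by simp
        have eq: "(\<lambda>z. (\<xi> z * \<xi> z) * f z) = (\<lambda>z. f q * (\<xi> z * \<xi> z) + (\<Sum>j\<in>Basis. w j z * g j z))"
        proof
          fix z
          show "(\<xi> z * \<xi> z) * f z = f q * (\<xi> z * \<xi> z) + (\<Sum>j\<in>Basis. w j z * g j z)"
          proof (cases "z \<in> U \<and> \<phi> z \<in> ?S")
            case True
            define T where "T = (\<Sum>i\<in>Basis. ((\<phi> z - \<phi> q) \<bullet> i) * G i (\<phi> z))"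
            have "f z = f q + T"
              using G(2)[of "\<phi> z"] True U by (simp add: chart_inv[OF c] T_def)
            moreover have "w j z * g j z = \<xi> z * \<xi> z * (((\<phi> z - \<phi> q) \<bullet> j) * G j (\<phi> z))" for j
              using True by (simp add: w_def g_def x_def \<xi>_def ext_def algebra_simps)
            then have "(\<Sum>j\<in>Basis. w j z * g j z) = \<xi> z * \<xi> z * T"
              unfolding T_def by (simp only: sum_distrib_left)
            ultimately show ?thesis by (simp add: algebra_simps)
          next
            case False
            then have "z \<in> U \<Longrightarrow> \<rho> (\<phi> z) = 0" using \<rho>(3)[of "\<phi> z"] R by auto
            then show ?thesis by (simp add: w_def g_def x_def \<xi>_def ext_def)
          qed
        qed
        have "v f = v (\<lambda>z. (\<xi> z * \<xi> z) * f z)"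
          using tangent_space_mult[OF v \<xi>\<xi> f] v\<xi>\<xi> \<xi>1 by simp
        also have "\<dots> = f q * v (\<lambda>z. \<xi> z * \<xi> z) + v (\<lambda>z. \<Sum>j\<in>Basis. w j z * g j z)"
          unfolding eq
          by (subst tangent_space_add[OF v]) (auto intro!: \<xi>\<xi> w g simp: tangent_space_cmult[OF v \<xi>\<xi>])
        also have "\<dots> = (\<Sum>j\<in>Basis. v (\<lambda>z. w j z * g j z))"
          unfolding v\<xi>\<xi> by (subst tangent_space_sum[OF v]) (auto intro: w g)
        \<comment> \<open>As \<open>w j\<close> vanishes at q, the Leibniz rule keeps only
          \<open>g j q * v (w j)\<close>; and v kills \<open>\<xi>\<close>, so \<open>w j\<close>
          may be replaced by \<open>x j\<close>.\<close>
        also have "\<dots> = (\<Sum>j\<in>Basis. v (x j) * E j q f)"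
        proof (rule sum.cong[OF refl])
          fix j :: 'e
          have "w j q = 0" using U \<rho>b by (simp add: w_def x_def \<xi>_def ext_def)
          moreover have "v (w j) = v (x j)"
            unfolding w_def
            by (subst tangent_space_diff[OF v]) (auto intro: x \<xi> simp: tangent_space_cmult[OF v \<xi>] v\<xi>)
          moreover have "g j q = E j q f"
            using U f G(3) \<rho>b by (simp add: g_def ext_def E_def)
          ultimately show "v (\<lambda>z. w j z * g j z) = v (x j) * E j q f"
            using tangent_space_mult[OF v w g] by (simp add: mult.commute)
        qed
        finally show ?thesis .
      qed
    qed
  qed
qed

end


subsection \<open>Covariant derivatives of 1-forms and the musical isomorphisms\<close>

text \<open>Determinants and Cramer's rule need a finite index type, and \<open>Basis\<close> is only a set.\<close>

typedef (overloaded) 'a basis_index = "Basis :: 'a::euclidean_space set"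
  morphisms basis_vector Basis_index
  using nonempty_Basis by blast

instance basis_index :: (euclidean_space) finite
proof
  have "inj (basis_vector :: 'a basis_index \<Rightarrow> 'a)"
    by (simp add: inj_def basis_vector_inject)
  moreover have "range (basis_vector :: 'a basis_index \<Rightarrow> 'a) \<subseteq> Basis"
    using basis_vector by blast
  ultimately show "finite (UNIV :: 'a basis_index set)"
    using finite_imageD finite_subset finite_Basis by metis
qed

lemma sum_basis_index: "(\<Sum>k\<in>UNIV. f (basis_vector k)) = (\<Sum>i\<in>(Basis :: 'a::euclidean_space set). f i)"
proof -
  have "bij_betw basis_vector UNIV (Basis :: 'a set)"
    using type_definition.Rep_range[OF type_definition_basis_index]
    by (simp add: bij_betw_def inj_def basis_vector_inject)
  then show ?thesis by (rule sum.reindex_bij_betw)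
qed

lemma linear_form_add: "linear_form A p \<omega> \<Longrightarrow> v \<in> tangent_space A p \<Longrightarrow> w \<in> tangent_space A p \<Longrightarrow>
    \<omega> (\<lambda>f. v f + w f) = \<omega> v + \<omega> w"
  and linear_form_scale: "linear_form A p \<omega> \<Longrightarrow> v \<in> tangent_space A p \<Longrightarrow> \<omega> (\<lambda>f. c * v f) = c * \<omega> v"
  unfolding linear_form_def by blast+

lemma linear_form_combination:
  assumes "linear_form A p \<omega>" "finite I" "\<And>i. i \<in> I \<Longrightarrow> v i \<in> tangent_space A p"
  shows "\<omega> (\<lambda>f. \<Sum>i\<in>I. c i * v i f) = (\<Sum>i\<in>I. c i * \<omega> (v i))"
  using assms(2,3)
proof (induction I rule: finite_induct)
  case empty
  show ?case using linear_form_scale[OF assms(1) tangent_space_zero, of 0] by simp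
next
  case (insert i I)
  have "\<omega> (\<lambda>f. c i * v i f + (\<Sum>i\<in>I. c i * v i f)) = \<omega> (\<lambda>f. c i * v i f) + \<omega> (\<lambda>f. \<Sum>i\<in>I. c i * v i f)"
    by (intro linear_form_add[OF assms(1)] tangent_space_scale tangent_space_combination insert.prems) auto
  moreover have "\<omega> (\<lambda>f. c i * v i f) = c i * \<omega> (v i)"
    by (intro linear_form_scale[OF assms(1)] insert.prems) simp
  ultimately show ?case using insert by simp
qed

lemma vector_fields_tangent: "X \<in> vector_fields A \<Longrightarrow> X p \<in> tangent_space A p"
  and vector_fields_smooth: "X \<in> vector_fields A \<Longrightarrow> f \<in> smooth_fun A \<Longrightarrow> deriv_along X f \<in> smooth_fun A"
  unfolding vector_fields_def by blast+

lemma one_forms_linear: "\<beta> \<in> one_forms A \<Longrightarrow> linear_form A p (\<beta> p)"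
  and one_forms_outside: "\<beta> \<in> one_forms A \<Longrightarrow> v \<notin> tangent_space A p \<Longrightarrow> \<beta> p v = 0"
  and one_forms_smooth: "\<beta> \<in> one_forms A \<Longrightarrow> Y \<in> vector_fields A \<Longrightarrow> eval_form \<beta> Y \<in> smooth_fun A"
  unfolding one_forms_def cotangent_space_def by blast+

lemma tensor_linear1: "h \<in> tensor_fields02 A \<Longrightarrow> w \<in> tangent_space A p \<Longrightarrow> linear_form A p (\<lambda>v. h p v w)"
  and tensor_linear2: "h \<in> tensor_fields02 A \<Longrightarrow> v \<in> tangent_space A p \<Longrightarrow> linear_form A p (h p v)"
  and tensor_outside: "h \<in> tensor_fields02 A \<Longrightarrow> w \<notin> tangent_space A p \<Longrightarrow> h p v w = 0"
  and tensor_smooth: "h \<in> tensor_fields02 A \<Longrightarrow> X \<in> vector_fields A \<Longrightarrow> Y \<in> vector_fields A \<Longrightarrow>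
    eval_tensor h X Y \<in> smooth_fun A"
  unfolding tensor_fields02_def by blast+

lemma linear_form_zero: "linear_form A p \<omega> \<Longrightarrow> \<omega> (\<lambda>f. 0) = 0"
  using linear_form_combination[of A p \<omega> "{}"] by simp

context smooth_manifold
begin

section \<open>Global vector fields and tensoriality\<close>

lemma vector_fields_combination:
  assumes "\<And>i. i \<in> I \<Longrightarrow> E i \<in> vector_fields A" "\<And>i. i \<in> I \<Longrightarrow> c i \<in> smooth_fun A"
  shows "(\<lambda>p f. \<Sum>i\<in>I. c i p * E i p f) \<in> vector_fields A" (is "?X \<in> _")
proof -
  have "deriv_along ?X f \<in> smooth_fun A" if "f \<in> smooth_fun A" for f
  proof -
    have "(\<lambda>p. \<Sum>i\<in>I. c i p * deriv_along (E i) f p) \<in> smooth_fun A"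
      by (intro smooth_fun_sum smooth_fun_mult assms vector_fields_smooth that)
    then show ?thesis by (simp add: deriv_along_def)
  qed
  moreover have "?X p \<in> tangent_space A p" for p
    by (rule tangent_space_combination) (use assms(1) vector_fields_tangent in blast)
  ultimately show ?thesis unfolding vector_fields_def by blast
qed

lemma zero_vector_field: "(\<lambda>p f. 0) \<in> vector_fields A"
  using vector_fields_combination[of "{}"] by simp

lemma zero_one_form: "(\<lambda>p v. 0) \<in> one_forms A"
  unfolding one_forms_def cotangent_space_def linear_form_def eval_form_def by auto

lemma sec_scale_vector_field:
  "X \<in> vector_fields A \<Longrightarrow> f \<in> smooth_fun A \<Longrightarrow> sec_scale f X \<in> vector_fields A"
  using vector_fields_combination[of "{True}" "\<lambda>_. X" "\<lambda>_. f"] by (simp add: sec_scale_def)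

text \<open>Take the combination of frame fields whose coefficients are frozen at the components of
  v. Global fields thus detect everything pointwise, which is what turns identities between sections
  into equalities.\<close>

lemma vector_field_through:
  assumes "v \<in> tangent_space A p"
  obtains Y where "Y \<in> vector_fields A" "Y p = v"
proof -
  obtain W \<psi> E x where W: "p \<in> W" and \<psi>: "\<psi> \<in> smooth_fun A" and E: "\<And>i. E i \<in> vector_fields A"
    and frame: "\<And>q v. q \<in> W \<Longrightarrow> v \<in> tangent_space A q \<Longrightarrow> v = (\<lambda>f. \<Sum>i\<in>(Basis :: 'e set). v (x i) * E i q f)"
    by (rule local_frame[of p]) blast
  have "(\<lambda>f. \<Sum>i\<in>(Basis :: 'e set). v (x i) * E i p f) = v" using frame[OF W assms] by (rule sym)
  then show thesis
    using that[of "\<lambda>q f. \<Sum>i\<in>(Basis :: 'e set). v (x i) * E i q f"]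
      vector_fields_combination[of Basis E "\<lambda>i q. v (x i)"] E by auto
qed

lemma one_forms_eqI:
  assumes "\<beta> \<in> one_forms A" "\<gamma> \<in> one_forms A"
    "\<And>Y p. Y \<in> vector_fields A \<Longrightarrow> eval_form \<beta> Y p = eval_form \<gamma> Y p"
  shows "\<beta> = \<gamma>"
proof (intro ext)
  fix p v
  show "\<beta> p v = \<gamma> p v"
  proof (cases "v \<in> tangent_space A p")
    case True
    then obtain Y where "Y \<in> vector_fields A" "Y p = v" using vector_field_through by blast
    then show ?thesis using assms(3)[of Y p] by (simp add: eval_form_def)
  qed (use assms one_forms_outside in metis)
qed

text \<open>The expansion of \<open>Z\<close> in a frame holds only on \<open>W\<close>, but that of \<open>\<psi>Z\<close> holds everywhere.\<close>

lemma tensorial_pointwise: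
  assumes add: "\<And>Y Y'. Y \<in> vector_fields A \<Longrightarrow> Y' \<in> vector_fields A \<Longrightarrow> L (sec_add Y Y') p = L Y p + L Y' p"
    and scale: "\<And>f Y. f \<in> smooth_fun A \<Longrightarrow> Y \<in> vector_fields A \<Longrightarrow> L (sec_scale f Y) p = f p * L Y p"
    and Y: "Y \<in> vector_fields A" "Y' \<in> vector_fields A" "Y p = Y' p"
  shows "L Y p = (L Y' p :: real)"
proof -
  obtain W \<psi> E x where p: "p \<in> W" and \<psi>: "\<psi> \<in> smooth_fun A" "\<psi> p = 1" "\<And>q. q \<notin> W \<Longrightarrow> \<psi> q = 0"
    and E: "\<And>i. E i \<in> vector_fields A" and x: "\<And>i. x i \<in> smooth_fun A"
    and frame: "\<And>q v. q \<in> W \<Longrightarrow> v \<in> tangent_space A q \<Longrightarrow> v = (\<lambda>f. \<Sum>i\<in>(Basis :: 'e set). v (x i) * E i q f)"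
    by (rule local_frame[of p]) blast
  have comb: "L (\<lambda>q f. \<Sum>i\<in>I. c i q * E i q f) p = (\<Sum>i\<in>I. c i p * L (E i) p)"
    if "finite I" "\<And>i. i \<in> I \<Longrightarrow> c i \<in> smooth_fun A" for I :: "'e set" and c
    using that
  proof (induction I rule: finite_induct)
    case empty
    have "L (sec_scale (\<lambda>q. 0) Y) p = 0" using scale[OF smooth_fun_const Y(1)] by simp
    then show ?case by (simp add: sec_scale_def)
  next
    case (insert i I)
    have "L (sec_add (sec_scale (c i) (E i)) (\<lambda>q f. \<Sum>i\<in>I. c i q * E i q f)) p =
        L (sec_scale (c i) (E i)) p + L (\<lambda>q f. \<Sum>i\<in>I. c i q * E i q f) p"
      by (intro add sec_scale_vector_field vector_fields_combination) (use insert.prems E in auto)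
    moreover have "L (sec_scale (c i) (E i)) p = c i p * L (E i) p" using scale E insert.prems by simp
    moreover have "sec_add (sec_scale (c i) (E i)) (\<lambda>q f. \<Sum>i\<in>I. c i q * E i q f)
        = (\<lambda>q f. \<Sum>i\<in>insert i I. c i q * E i q f)"
      using insert.hyps by (simp add: sec_add_def sec_scale_def)
    ultimately show ?case using insert by simp
  qed
  \<comment> \<open>As \<open>\<psi> p = 1\<close>, L takes the same value at p on Z and on \<psi>Z.
    The expansion of \<psi>Z then leaves a formula in which Z enters only through its value at
    p.\<close>
  have "L Z p = (\<Sum>i\<in>(Basis :: 'e set). Z p (x i) * L (E i) p)" if Z: "Z \<in> vector_fields A" for Z
  proof -
    have "sec_scale \<psi> Z = (\<lambda>q f. \<Sum>i\<in>(Basis :: 'e set). (\<psi> q * deriv_along Z (x i) q) * E i q f)"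
    proof (intro ext)
      fix q f
      show "sec_scale \<psi> Z q f = (\<Sum>i\<in>(Basis :: 'e set). (\<psi> q * deriv_along Z (x i) q) * E i q f)"
      proof (cases "q \<in> W")
        case True
        have "Z q f = (\<Sum>i\<in>(Basis :: 'e set). Z q (x i) * E i q f)"
          using fun_cong[OF frame[OF True vector_fields_tangent[OF Z]]] .
        then show ?thesis
          by (simp only: sec_scale_def deriv_along_def sum_distrib_left mult.assoc)
      qed (simp add: sec_scale_def \<psi>(3))
    qed
    moreover have "(\<lambda>q. \<psi> q * deriv_along Z (x i) q) \<in> smooth_fun A" for i
      by (intro smooth_fun_mult \<psi>(1) vector_fields_smooth Z x)
    ultimately show ?thesis
      using scale[OF \<psi>(1) Z] comb[of Basis "\<lambda>i q. \<psi> q * deriv_along Z (x i) q"] \<psi>(2)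
      by (simp add: deriv_along_def)
  qed
  then show ?thesis using Y by simp
qed

text \<open>The value on v is read off from a chosen field through v. Tensoriality makes the choice
  immaterial, so for sums and multiples one may pick the sum or multiple of the chosen fields, which
  gives linearity.\<close>

lemma one_form_of_tensorial:
  assumes smooth: "\<And>Y. Y \<in> vector_fields A \<Longrightarrow> L Y \<in> smooth_fun A"
    and add: "\<And>Y Y' p. Y \<in> vector_fields A \<Longrightarrow> Y' \<in> vector_fields A \<Longrightarrow> L (sec_add Y Y') p = L Y p + L Y' p"
    and scale: "\<And>f Y p. f \<in> smooth_fun A \<Longrightarrow> Y \<in> vector_fields A \<Longrightarrow> L (sec_scale f Y) p = f p * L Y p"
  shows "\<exists>\<gamma>\<in>one_forms A. \<forall>Y\<in>vector_fields A. eval_form \<gamma> Y = L Y"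
proof -
  define through where "through p v = (SOME Y. Y \<in> vector_fields A \<and> Y p = v)" for p v
  have th: "through p v \<in> vector_fields A" "through p v p = v" if "v \<in> tangent_space A p" for p v
  proof -
    have "\<exists>Y. Y \<in> vector_fields A \<and> Y p = v" using vector_field_through[OF that] by blast
    from someI_ex[OF this] show "through p v \<in> vector_fields A" "through p v p = v"
      unfolding through_def by blast+
  qed
  define \<gamma> where "\<gamma> p v = (if v \<in> tangent_space A p then L (through p v) p else 0)" for p v
  have \<gamma>: "\<gamma> p (Y p) = L Y p" if Y: "Y \<in> vector_fields A" for Y p
  proof -
    note T = vector_fields_tangent[OF Y, of p]
    have "L (through p (Y p)) p = L Y p"
      by (rule tensorial_pointwise[of L p "through p (Y p)" Y, OF add scale th(1)[OF T] Y th(2)[OF T]])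
    then show ?thesis using T by (simp add: \<gamma>_def)
  qed
  have lin: "linear_form A p (\<gamma> p)" for p
    unfolding linear_form_def
  proof (intro conjI ballI allI)
    fix v w assume vw: "v \<in> tangent_space A p" "w \<in> tangent_space A p"
    obtain Y Z where Y: "Y \<in> vector_fields A" "Y p = v" and Z: "Z \<in> vector_fields A" "Z p = w"
      using vw vector_field_through by metis
    have "sec_add Y Z \<in> vector_fields A"
      using vector_fields_combination[of UNIV "\<lambda>b. if b then Y else Z" "\<lambda>_ _. 1"] Y Z
      by (simp add: UNIV_bool sec_add_def add.commute)
    from \<gamma>[OF this, of p] \<gamma>[OF Y(1), of p] \<gamma>[OF Z(1), of p] add[OF Y(1) Z(1)] Y(2) Z(2)
    show "\<gamma> p (\<lambda>f. v f + w f) = \<gamma> p v + \<gamma> p w" by (simp add: sec_add_def)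
  next
    fix c v assume v: "v \<in> tangent_space A p"
    obtain Y where Y: "Y \<in> vector_fields A" "Y p = v" using v vector_field_through by metis
    from \<gamma>[OF sec_scale_vector_field[OF Y(1) smooth_fun_const[of c]], of p] \<gamma>[OF Y(1), of p]
      scale[OF smooth_fun_const[of c] Y(1), of p] Y(2)
    show "\<gamma> p (\<lambda>f. c * v f) = c * \<gamma> p v" by (simp add: sec_scale_def)
  qed
  have ev: "eval_form \<gamma> Y = L Y" if "Y \<in> vector_fields A" for Y
    using \<gamma>[OF that] by (auto simp: eval_form_def)
  have "\<gamma> \<in> one_forms A"
    unfolding one_forms_def cotangent_space_def using lin ev smooth by (auto simp: \<gamma>_def)
  with ev show ?thesis by blast
qed

lemma eval_form_sec_add:
  "\<beta> \<in> one_forms A \<Longrightarrow> Y \<in> vector_fields A \<Longrightarrow> Z \<in> vector_fields A \<Longrightarrow>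
    eval_form \<beta> (sec_add Y Z) p = eval_form \<beta> Y p + eval_form \<beta> Z p"
  unfolding eval_form_def sec_add_def
  by (rule linear_form_add) (auto intro: one_forms_linear vector_fields_tangent)

lemma eval_form_sec_scale:
  "\<beta> \<in> one_forms A \<Longrightarrow> Y \<in> vector_fields A \<Longrightarrow> eval_form \<beta> (sec_scale f Y) p = f p * eval_form \<beta> Y p"
  unfolding eval_form_def sec_scale_def
  by (rule linear_form_scale) (auto intro: one_forms_linear vector_fields_tangent)

text \<open>The expression X(\<beta>(Y)) - \<beta>(D X Y) is tensorial in Y: the terms (X f)
  \<beta>(Y) produced by the two Leibniz rules cancel. This supplies existence for the definite
  description; uniqueness holds because global fields separate 1-forms.\<close>

lemma cov_form:
  assumes D: "affine_connection A D" and X: "X \<in> vector_fields A" and \<beta>: "\<beta> \<in> one_forms A"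
  shows "cov_form A D X \<beta> \<in> one_forms A"
    and "Y \<in> vector_fields A \<Longrightarrow>
      eval_form (cov_form A D X \<beta>) Y p = deriv_along X (eval_form \<beta> Y) p - eval_form \<beta> (D X Y) p"
proof -
  define L where "L Y = (\<lambda>p. deriv_along X (eval_form \<beta> Y) p - eval_form \<beta> (D X Y) p)" for Y
  have DX: "D X Y \<in> vector_fields A" if "Y \<in> vector_fields A" for Y
    using D X that unfolding affine_connection_def by blast
  note XT = vector_fields_tangent[OF X]
  note \<beta>s = one_forms_smooth[OF \<beta>]
  have "\<exists>\<gamma>\<in>one_forms A. \<forall>Y\<in>vector_fields A. eval_form \<gamma> Y = L Y"
  proof (rule one_form_of_tensorial)
    show "L Y \<in> smooth_fun A" if "Y \<in> vector_fields A" for Y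
      unfolding L_def by (intro smooth_fun_diff vector_fields_smooth X \<beta>s DX that)
    show "L (sec_add Y Z) p = L Y p + L Z p" if Y: "Y \<in> vector_fields A" and Z: "Z \<in> vector_fields A" for Y Z p
    proof -
      have "D X (sec_add Y Z) = sec_add (D X Y) (D X Z)"
        using D X Y Z unfolding affine_connection_def by blast
      moreover have "eval_form \<beta> (sec_add Y Z) = (\<lambda>q. eval_form \<beta> Y q + eval_form \<beta> Z q)"
        using eval_form_sec_add[OF \<beta> Y Z] by blast
      ultimately show ?thesis
        using tangent_space_add[OF XT \<beta>s[OF Y] \<beta>s[OF Z]] eval_form_sec_add[OF \<beta> DX[OF Y] DX[OF Z]]
        by (simp add: L_def deriv_along_def)
    qed
    show "L (sec_scale f Y) p = f p * L Y p" if f: "f \<in> smooth_fun A" and Y: "Y \<in> vector_fields A" for f Y p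
    proof -
      have "D X (sec_scale f Y) = sec_add (sec_scale (deriv_along X f) Y) (sec_scale f (D X Y))"
        using D X Y f unfolding affine_connection_def by blast
      moreover have "eval_form \<beta> (sec_scale f Y) = (\<lambda>q. f q * eval_form \<beta> Y q)"
        using eval_form_sec_scale[OF \<beta> Y] by blast
      moreover have "eval_form \<beta> (sec_add (sec_scale (deriv_along X f) Y) (sec_scale f (D X Y))) p
          = X p f * eval_form \<beta> Y p + f p * eval_form \<beta> (D X Y) p"
        using eval_form_sec_add[OF \<beta> sec_scale_vector_field[OF Y vector_fields_smooth[OF X f]]
            sec_scale_vector_field[OF DX[OF Y] f]]
          eval_form_sec_scale[OF \<beta> Y] eval_form_sec_scale[OF \<beta> DX[OF Y]] by (simp add: deriv_along_def)
      ultimately show ?thesis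
        using tangent_space_mult[OF XT f \<beta>s[OF Y]]
        by (simp add: L_def deriv_along_def algebra_simps)
    qed
  qed
  then obtain \<gamma> where \<gamma>: "\<gamma> \<in> one_forms A" "\<And>Y. Y \<in> vector_fields A \<Longrightarrow> eval_form \<gamma> Y = L Y" by blast
  define P where "P \<gamma> \<longleftrightarrow> \<gamma> \<in> one_forms A \<and> (\<forall>Y\<in>vector_fields A. \<forall>p. eval_form \<gamma> Y p = L Y p)" for \<gamma>
  have "P (THE \<gamma>. P \<gamma>)"
  proof (rule theI[of P \<gamma>])
    show "P \<gamma>" using \<gamma> by (simp add: P_def)
    then show "\<gamma>' = \<gamma>" if "P \<gamma>'" for \<gamma>'
      using one_forms_eqI[of \<gamma>' \<gamma>] that by (simp add: P_def)
  qed
  then have "P (cov_form A D X \<beta>)" unfolding cov_form_def P_def L_def .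
  then show "cov_form A D X \<beta> \<in> one_forms A"
    and "Y \<in> vector_fields A \<Longrightarrow>
      eval_form (cov_form A D X \<beta>) Y p = deriv_along X (eval_form \<beta> Y) p - eval_form \<beta> (D X Y) p"
    unfolding P_def L_def by blast+
qed

section \<open>Inverting h smoothly\<close>

lemma flat_one_form:
  assumes "h \<in> tensor_fields02 A" "X \<in> vector_fields A"
  shows "flat h X \<in> one_forms A"
  using assms tensor_linear2 tensor_outside tensor_smooth[of h A X] vector_fields_tangent
  unfolding one_forms_def cotangent_space_def flat_def eval_form_def eval_tensor_def by blast

lemma nondegenerate_inj:
  assumes h: "h \<in> tensor_fields02 A" "nondegenerate A h"
    and vw: "v \<in> tangent_space A p" "w \<in> tangent_space A p"
    and eq: "\<And>u. u \<in> tangent_space A p \<Longrightarrow> h p v u = h p w u"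
  shows "v = w"
proof -
  have w': "(\<lambda>f. (- 1) * w f) \<in> tangent_space A p" by (rule tangent_space_scale[OF vw(2)])
  have "h p (\<lambda>f. v f + (- 1) * w f) u = 0" if u: "u \<in> tangent_space A p" for u
    using linear_form_add[OF tensor_linear1[OF h(1) u] vw(1) w'] eq[OF u]
      linear_form_scale[OF tensor_linear1[OF h(1) u] vw(2), of "- 1"] by simp
  then have "(\<lambda>f. v f + (- 1) * w f) = (\<lambda>f. 0)"
    using h(2) tangent_space_plus[OF vw(1) w'] unfolding nondegenerate_def by blast
  then have "v f + (- 1) * w f = 0" for f by (rule fun_cong)
  then show ?thesis by (auto simp: fun_eq_iff)
qed

lemma smooth_det:
  assumes "\<And>i j. (\<lambda>q. M q $ i $ j) \<in> smooth_fun A"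
  shows "(\<lambda>q. det (M q)) \<in> smooth_fun A"
  unfolding det_def by (intro smooth_fun_sum smooth_fun_mult smooth_fun_const smooth_fun_prod assms)

text \<open>By Cramer's rule d is the determinant and the \<open>u i\<close> are its numerators. All
  are polynomials in the data, hence smooth on the whole manifold; only the division is confined to
  points where the homogeneous system has no nontrivial solution.\<close>

lemma smooth_linear_solution:
  fixes H :: "'e \<Rightarrow> 'e \<Rightarrow> 'm \<Rightarrow> real" and b :: "'e \<Rightarrow> 'm \<Rightarrow> real"
  assumes H: "\<And>i j. H i j \<in> smooth_fun A" and b: "\<And>j. b j \<in> smooth_fun A"
  obtains u d where "\<And>i. u i \<in> smooth_fun A" "d \<in> smooth_fun A"
    "\<And>q. (\<And>c i. (\<And>j. j \<in> Basis \<Longrightarrow> (\<Sum>i\<in>(Basis :: 'e set). c i * H i j q) = 0) \<Longrightarrow> i \<in> Basis \<Longrightarrow> c i = 0)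
      \<Longrightarrow> d q \<noteq> 0"
    "\<And>q j. d q \<noteq> 0 \<Longrightarrow> j \<in> Basis \<Longrightarrow> (\<Sum>i\<in>(Basis :: 'e set). (u i q / d q) * H i j q) = b j q"
proof -
  \<comment> \<open>Rows are indexed by the equation j and columns by the unknown i, since the
    unknown vector sits in the first slot of \<open>H\<close>.\<close>
  define M :: "'m \<Rightarrow> real ^ 'e basis_index ^ 'e basis_index"
    where "M q = (\<chi> j i. H (basis_vector i) (basis_vector j) q)" for q
  define B :: "'m \<Rightarrow> real ^ 'e basis_index" where "B q = (\<chi> j. b (basis_vector j) q)" for q
  define U where "U k q = det (\<chi> i j. if j = k then B q $ i else M q $ i $ j)" for k q
  have Mc: "(M q *v c) $ j = (\<Sum>i\<in>Basis. c $ Basis_index i * H i (basis_vector j) q)" for q c j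
    unfolding sum_basis_index[symmetric]
    by (simp add: matrix_vector_mult_def M_def basis_vector_inverse mult.commute)
  have bi: "basis_vector (Basis_index i) = i" if "i \<in> Basis" for i :: 'e
    using that by (rule Basis_index_inverse)
  show thesis
  proof
    show "U (Basis_index i) \<in> smooth_fun A" for i
    proof -
      have "(\<lambda>q. (\<chi> i j. if j = k then B q $ i else M q $ i $ j) $ i' $ j') \<in> smooth_fun A" for k i' j'
        using H b by (cases "j' = k") (auto simp: B_def M_def)
      then show ?thesis unfolding U_def by (intro smooth_det)
    qed
    show "(\<lambda>q. det (M q)) \<in> smooth_fun A"
      by (rule smooth_det) (simp add: M_def H)
    show "det (M q) \<noteq> 0"
      if ker: "\<And>c i. (\<And>j. j \<in> Basis \<Longrightarrow> (\<Sum>i\<in>(Basis :: 'e set). c i * H i j q) = 0) \<Longrightarrow> i \<in> Basis \<Longrightarrow> c i = 0" for q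
    proof -
      have "c = 0" if c: "M q *v c = 0" for c
      proof -
        have "(\<Sum>i\<in>(Basis :: 'e set). c $ Basis_index i * H i j q) = 0" if "j \<in> Basis" for j
          using Mc[of q c "Basis_index j"] c bi[OF that] by simp
        then have "c $ Basis_index i = 0" if "i \<in> Basis" for i
          using ker[of "\<lambda>i. c $ Basis_index i" i] that by blast
        then show ?thesis
          unfolding vec_eq_iff by (metis basis_vector basis_vector_inverse zero_index)
      qed
      then have "invertible (M q)"
        using matrix_left_invertible_ker invertible_left_inverse by blast
      then show ?thesis by (simp add: invertible_det_nz)
    qed
    show "(\<Sum>i\<in>(Basis :: 'e set). (U (Basis_index i) q / det (M q)) * H i j q) = b j q"
      if d: "det (M q) \<noteq> 0" and j: "j \<in> Basis" for q j
    proof -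
      have "M q *v (\<chi> k. U k q / det (M q)) = B q"
        using cramer[OF d] unfolding U_def by blast
      then have "(M q *v (\<chi> k. U k q / det (M q))) $ Basis_index j = b j q"
        by (simp add: B_def bi[OF j])
      then show ?thesis unfolding Mc by (simp add: bi[OF j])
    qed
  qed
qed

text \<open>Over a frame, h(V, \<cdot>) = \<beta> is a linear system for the components of V with
  matrix h(E_i, E_j). Nondegeneracy gives it a trivial kernel, so Cramer's rule solves it. Hence
  \<beta> lies in the image of h at each point, which makes \<open>inv_into\<close> a genuine
  preimage; by injectivity that preimage is Cramer's solution, with quotients of smooth functions as
  coefficients.\<close>

lemma sharp:
  assumes h: "h \<in> tensor_fields02 A" "nondegenerate A h" and \<beta>: "\<beta> \<in> one_forms A"
  shows "sharp A h \<beta> \<in> vector_fields A" and "flat h (sharp A h \<beta>) = \<beta>"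
proof -
  have loc: "\<exists>W u d E. open W \<and> p \<in> W \<and> (\<forall>i. u i \<in> smooth_fun A) \<and> d \<in> smooth_fun A \<and> (\<forall>i. E i \<in> vector_fields A) \<and>
      (\<forall>q\<in>W. d q \<noteq> 0 \<and> h q (\<lambda>f. \<Sum>i\<in>(Basis :: 'e set). (u i q / d q) * E i q f) = \<beta> q)" for p
  proof -
    obtain W \<psi> E x where W: "open W" "p \<in> W"
      and E: "\<And>i. E i \<in> vector_fields A" and x: "\<And>i. x i \<in> smooth_fun A"
      and frame: "\<And>q v. q \<in> W \<Longrightarrow> v \<in> tangent_space A q \<Longrightarrow> v = (\<lambda>f. \<Sum>i\<in>(Basis :: 'e set). v (x i) * E i q f)"
      and dual: "\<And>q i j. q \<in> W \<Longrightarrow> i \<in> Basis \<Longrightarrow> j \<in> Basis \<Longrightarrow> E i q (x j) = (if i = j then 1 else 0)"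
      by (rule local_frame[of p]) blast
    have ET: "E i q \<in> tangent_space A q" for i q using vector_fields_tangent[OF E] .
    have comb: "\<omega> (\<lambda>f. \<Sum>i\<in>Basis. c i * E i q f) = (\<Sum>i\<in>Basis. c i * \<omega> (E i q))"
      if "linear_form A q \<omega>" for q \<omega> c
      by (rule linear_form_combination[OF that]) (auto intro: ET)
    \<comment> \<open>Linear forms at a point of \<open>W\<close> are compared on the frame
      alone.\<close>
    have ext: "\<omega> w = \<omega>' w"
      if "q \<in> W" "linear_form A q \<omega>" "linear_form A q \<omega>'" "\<And>j. j \<in> Basis \<Longrightarrow> \<omega> (E j q) = \<omega>' (E j q)"
        "w \<in> tangent_space A q" for q \<omega> \<omega>' w
      using comb[OF that(2), of "\<lambda>i. w (x i)"] comb[OF that(3), of "\<lambda>i. w (x i)"]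
        frame[OF that(1,5)] that(4) by simp
    define H where "H i j = eval_tensor h (E i) (E j)" for i j
    have H: "H i j \<in> smooth_fun A" for i j unfolding H_def by (rule tensor_smooth[OF h(1) E E])
    have b: "eval_form \<beta> (E j) \<in> smooth_fun A" for j by (rule one_forms_smooth[OF \<beta> E])
    obtain u d where ud: "\<And>i. u i \<in> smooth_fun A" "d \<in> smooth_fun A"
      "\<And>q. (\<And>c i. (\<And>j. j \<in> Basis \<Longrightarrow> (\<Sum>i\<in>(Basis :: 'e set). c i * H i j q) = 0) \<Longrightarrow> i \<in> Basis \<Longrightarrow> c i = 0)
        \<Longrightarrow> d q \<noteq> 0"
      "\<And>q j. d q \<noteq> 0 \<Longrightarrow> j \<in> Basis \<Longrightarrow> (\<Sum>i\<in>(Basis :: 'e set). (u i q / d q) * H i j q) = eval_form \<beta> (E j) q"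
      by (rule smooth_linear_solution[of H "\<lambda>j. eval_form \<beta> (E j)", OF H b]) blast
    have hc: "h q (\<lambda>f. \<Sum>i\<in>(Basis :: 'e set). c i * E i q f) (E j q) = (\<Sum>i\<in>Basis. c i * H i j q)" for q c j
      using comb[OF tensor_linear1[OF h(1) ET[of j]]]
      by (simp add: H_def eval_tensor_def)
    have CT: "(\<lambda>f. \<Sum>i\<in>(Basis :: 'e set). c i * E i q f) \<in> tangent_space A q" for c q
      by (rule tangent_space_combination[OF ET])
    have main: "d q \<noteq> 0 \<and> h q (\<lambda>f. \<Sum>i\<in>(Basis :: 'e set). (u i q / d q) * E i q f) = \<beta> q" if q: "q \<in> W" for q
    proof
      show d: "d q \<noteq> 0"
      proof (rule ud(3))
        fix c :: "'e \<Rightarrow> real" and i :: 'e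
        assume c: "\<And>j. j \<in> Basis \<Longrightarrow> (\<Sum>i\<in>(Basis :: 'e set). c i * H i j q) = 0" and i: "i \<in> Basis"
        let ?v = "\<lambda>f. \<Sum>i\<in>(Basis :: 'e set). c i * E i q f"
        have "h q ?v w = 0" if "w \<in> tangent_space A q" for w
          by (rule ext[OF q tensor_linear2[OF h(1) CT]]) (use that c hc in \<open>auto simp: linear_form_def\<close>)
        then have "?v = (\<lambda>f. 0)" using h(2) CT unfolding nondegenerate_def by blast
        then have "?v (x i) = 0" by (rule fun_cong)
        \<comment> \<open>The cut-off coordinates are dual to the frame, so applying the vector to
          \<open>x i\<close> extracts its i-th coefficient.\<close>
        moreover have "?v (x i) = c i"
          using dual[OF q _ i] i by (simp add: if_distrib[of "\<lambda>t. _ * t"] cong: if_cong)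
        ultimately show "c i = 0" by simp
      qed
      show "h q (\<lambda>f. \<Sum>i\<in>(Basis :: 'e set). (u i q / d q) * E i q f) = \<beta> q" (is "h q ?v = _")
      proof
        fix w
        show "h q ?v w = \<beta> q w"
        proof (cases "w \<in> tangent_space A q")
          case True
          show ?thesis
            by (rule ext[OF q tensor_linear2[OF h(1) CT] one_forms_linear[OF \<beta>] _ True])
              (use hc[of q "\<lambda>i. u i q / d q"] ud(4)[OF d] in \<open>simp add: eval_form_def\<close>)
        qed (simp add: tensor_outside[OF h(1)] one_forms_outside[OF \<beta>])
      qed
    qed
    show ?thesis
      by (intro exI[of _ W] exI[of _ u] exI[of _ d] exI[of _ E] conjI allI ballI W ud(1,2) E
          conjunct1[OF main] conjunct2[OF main])
  qed
  have sh: "sharp A h \<beta> q \<in> tangent_space A q" "h q (sharp A h \<beta> q) = \<beta> q" for q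
  proof -
    obtain u d E where E: "\<And>i. E i \<in> vector_fields A"
      and eq: "h q (\<lambda>f. \<Sum>i\<in>(Basis :: 'e set). (u i q / d q) * E i q f) = \<beta> q"
      using loc[of q] by blast
    have "(\<lambda>f. \<Sum>i\<in>(Basis :: 'e set). (u i q / d q) * E i q f) \<in> tangent_space A q"
      by (rule tangent_space_combination) (rule vector_fields_tangent[OF E])
    with eq have "\<beta> q \<in> h q ` tangent_space A q" by force
    then show "sharp A h \<beta> q \<in> tangent_space A q" "h q (sharp A h \<beta> q) = \<beta> q"
      unfolding sharp_def by (rule inv_into_into, rule f_inv_into_f)
  qed
  then show "flat h (sharp A h \<beta>) = \<beta>" unfolding flat_def by blast
  have "deriv_along (sharp A h \<beta>) f \<in> smooth_fun A" if f: "f \<in> smooth_fun A" for f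
  proof (rule smooth_fun_quotient)
    fix p
    obtain W u d E where W: "open W" "p \<in> W" and ud: "\<And>i. u i \<in> smooth_fun A" "d \<in> smooth_fun A"
      and E: "\<And>i. E i \<in> vector_fields A"
      and eq: "\<And>q. q \<in> W \<Longrightarrow> d q \<noteq> 0 \<and> h q (\<lambda>f. \<Sum>i\<in>(Basis :: 'e set). (u i q / d q) * E i q f) = \<beta> q"
      using loc[of p] by blast
    have "(\<lambda>q. \<Sum>i\<in>(Basis :: 'e set). u i q * deriv_along (E i) f q) \<in> smooth_fun A" (is "?n \<in> _")
      by (intro smooth_fun_sum smooth_fun_mult ud vector_fields_smooth E f)
    moreover have "deriv_along (sharp A h \<beta>) f q = ?n q / d q" if q: "q \<in> W" for q
    proof -
      have "sharp A h \<beta> q = (\<lambda>f. \<Sum>i\<in>(Basis :: 'e set). (u i q / d q) * E i q f)"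
        by (rule nondegenerate_inj[OF h sh(1) tangent_space_combination])
          (use eq[OF q] sh(2)[of q] vector_fields_tangent[OF E] in auto)
      then show ?thesis by (simp add: deriv_along_def sum_divide_distrib)
    qed
    ultimately show "\<exists>N u d. open N \<and> p \<in> N \<and> u \<in> smooth_fun A \<and> d \<in> smooth_fun A \<and>
        (\<forall>q\<in>N. d q \<noteq> 0 \<and> deriv_along (sharp A h \<beta>) f q = u q / d q)"
      using W ud(2) eq by blast
  qed
  then show "sharp A h \<beta> \<in> vector_fields A"
    unfolding vector_fields_def using sh(1) by blast
qed

end


subsection \<open>The generalized dual connection\<close>

context smooth_manifold
begin

text \<open>Merges the two branches into one formula, so that the computations below carry a sign
  instead of a case distinction.\<close>

lemma hat_h_sign:
  "hat_h A h (Y, \<beta>) (Z, \<gamma>) = (\<lambda>p. - (1 / 2) * (eval_form \<beta> Z p + (if symmetric02 A h then 1 else - 1) * eval_form \<gamma> Y p))"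
  by (auto simp: hat_h_def fun_eq_iff)

lemma gen_dual_identity:
  assumes h: "h \<in> tensor_fields02 A" "nondegenerate A h" and sym: "symmetric02 A h \<or> skew02 A h"
    and D: "affine_connection A D"
    and X: "X \<in> vector_fields A" and Y: "Y \<in> vector_fields A" and Z: "Z \<in> vector_fields A"
    and \<beta>: "\<beta> \<in> one_forms A" and \<gamma>: "\<gamma> \<in> one_forms A"
  shows "hat_h A h (Y, \<beta>) (sharp A h (cov_form A D X (flat h Z)), cov_form A D X \<gamma>) p =
    deriv_along X (hat_h A h (Y, \<beta>) (Z, \<gamma>)) p - hat_h A h (hat_nabla A h D (X, \<alpha>) (Y, \<beta>)) (Z, \<gamma>) p"
proof -
  define s :: real where "s = (if symmetric02 A h then 1 else - 1)"
  have ss: "s * s = 1" by (simp add: s_def)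
  have hs: "h q v w = s * h q w v" if "v \<in> tangent_space A q" "w \<in> tangent_space A q" for q v w
    using sym that unfolding s_def symmetric02_def skew02_def by auto
  define B where "B = sharp A h \<beta>"
  have B: "B \<in> vector_fields A" "flat h B = \<beta>" unfolding B_def by (rule sharp[OF h \<beta>])+
  have DB: "D X B \<in> vector_fields A" using D X B(1) unfolding affine_connection_def by blast
  define \<omega> where "\<omega> = cov_form A D X (flat h Z)"
  note fZ = flat_one_form[OF h(1) Z]
  have \<omega>: "\<omega> \<in> one_forms A" unfolding \<omega>_def by (rule cov_form(1)[OF D X fZ])
  have swap: "eval_form (flat h V) W q = s * eval_form (flat h W) V q"
    if "V \<in> vector_fields A" "W \<in> vector_fields A" for V W q
    using hs vector_fields_tangent[OF that(1)] vector_fields_tangent[OF that(2)]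
    unfolding eval_form_def flat_def by blast
  \<comment> \<open>With V = h^(-1)(\<omega>): \<beta>(V) = h(B,V) = s h(V,B) = s \<omega>(B).
    Unfolding \<omega> and swapping B and D X B past Z gives a second s, and the two cancel.\<close>
  have "eval_form \<beta> (sharp A h \<omega>) p = s * eval_form \<omega> B p"
    using swap[OF B(1) sharp(1)[OF h \<omega>]] by (simp add: B(2) sharp(2)[OF h \<omega>])
  also have "eval_form \<omega> B p = deriv_along X (eval_form (flat h Z) B) p - eval_form (flat h Z) (D X B) p"
    unfolding \<omega>_def by (rule cov_form(2)[OF D X fZ B(1)])
  also have "eval_form (flat h Z) B = (\<lambda>q. s * eval_form \<beta> Z q)"
    using swap[OF Z B(1)] by (auto simp: B(2))
  also have "deriv_along X (\<lambda>q. s * eval_form \<beta> Z q) p = s * deriv_along X (eval_form \<beta> Z) p"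
    unfolding deriv_along_def
    by (rule tangent_space_cmult[OF vector_fields_tangent[OF X] one_forms_smooth[OF \<beta> Z]])
  also have "eval_form (flat h Z) (D X B) p = s * eval_form (flat h (D X B)) Z p"
    by (rule swap[OF Z DB])
  also have "s * (s * deriv_along X (eval_form \<beta> Z) p - s * eval_form (flat h (D X B)) Z p)
      = (s * s) * (deriv_along X (eval_form \<beta> Z) p - eval_form (flat h (D X B)) Z p)"
    by (simp add: algebra_simps)
  finally have 1: "eval_form \<beta> (sharp A h \<omega>) p =
      deriv_along X (eval_form \<beta> Z) p - eval_form (flat h (D X B)) Z p" by (simp add: ss)
  have 2: "eval_form (cov_form A D X \<gamma>) Y p = deriv_along X (eval_form \<gamma> Y) p - eval_form \<gamma> (D X Y) p"
    by (rule cov_form(2)[OF D X \<gamma> Y])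
  \<comment> \<open>Tangent vectors are linear on smooth functions only, so each summand must be
    known to be smooth before X is distributed.\<close>
  have \<gamma>Y: "(\<lambda>q. s * eval_form \<gamma> Y q) \<in> smooth_fun A"
    by (intro smooth_fun_mult smooth_fun_const one_forms_smooth[OF \<gamma> Y])
  have 3: "deriv_along X (\<lambda>q. - (1 / 2) * (eval_form \<beta> Z q + s * eval_form \<gamma> Y q)) p =
      - (1 / 2) * (deriv_along X (eval_form \<beta> Z) p + s * deriv_along X (eval_form \<gamma> Y) p)"
    unfolding deriv_along_def
    by (simp only: tangent_space_cmult[OF vector_fields_tangent[OF X] smooth_fun_add[OF one_forms_smooth[OF \<beta> Z] \<gamma>Y]]
        tangent_space_add[OF vector_fields_tangent[OF X] one_forms_smooth[OF \<beta> Z] \<gamma>Y]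
        tangent_space_cmult[OF vector_fields_tangent[OF X] one_forms_smooth[OF \<gamma> Y]])
  show ?thesis
    unfolding hat_nabla_def prod.case hat_h_sign s_def[symmetric] \<omega>_def[symmetric] B_def[symmetric] 1 2 3
    by (simp add: algebra_simps)
qed

text \<open>Testing with \<beta> = 0 isolates \<gamma>; testing with Y = 0 isolates \<beta>(Z).
  Forms \<beta> = h(B), with B running through fields of arbitrary value at p, then separate the
  values of Z by nondegeneracy of h.\<close>

lemma hat_h_nondegenerate:
  assumes h: "h \<in> tensor_fields02 A" "nondegenerate A h" and sym: "symmetric02 A h \<or> skew02 A h"
    and Z: "Z \<in> vector_fields A" "Z' \<in> vector_fields A" and \<gamma>: "\<gamma> \<in> one_forms A" "\<gamma>' \<in> one_forms A"
    and eq: "\<And>Y \<beta> p. Y \<in> vector_fields A \<Longrightarrow> \<beta> \<in> one_forms A \<Longrightarrow>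
      hat_h A h (Y, \<beta>) (Z, \<gamma>) p = hat_h A h (Y, \<beta>) (Z', \<gamma>') p"
  shows "Z = Z' \<and> \<gamma> = \<gamma>'"
proof
  show "\<gamma> = \<gamma>'"
    using \<gamma> by (rule one_forms_eqI)
      (use eq[OF _ zero_one_form] in
        \<open>cases "symmetric02 A h"; simp add: hat_h_sign eval_form_def\<close>)
  have \<beta>: "\<beta> p (Z p) = \<beta> p (Z' p)" if "\<beta> \<in> one_forms A" for \<beta> p
    using eq[OF zero_vector_field that, of p]
      linear_form_zero[OF one_forms_linear[OF \<gamma>(1)]] linear_form_zero[OF one_forms_linear[OF \<gamma>(2)]]
    by (simp add: hat_h_sign eval_form_def)
  show "Z = Z'"
  proof
    fix p
    show "Z p = Z' p"
    proof (rule nondegenerate_inj[OF h vector_fields_tangent[OF Z(1)] vector_fields_tangent[OF Z(2)]])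
      fix u assume u: "u \<in> tangent_space A p"
      then obtain B where B: "B \<in> vector_fields A" "B p = u" using vector_field_through by blast
      have "h p u (Z p) = h p u (Z' p)"
        using \<beta>[OF flat_one_form[OF h(1) B(1)], of p] B(2) by (simp add: flat_def)
      moreover have "h p u v = (if symmetric02 A h then 1 else - 1) * h p v u" if "v \<in> tangent_space A p" for v
        using sym u that unfolding symmetric02_def skew02_def by auto
      ultimately show "h p (Z p) u = h p (Z' p) u"
        using vector_fields_tangent[OF Z(1), of p] vector_fields_tangent[OF Z(2), of p]
        by (cases "symmetric02 A h") simp_all
    qed
  qed
qed

end

theorem proposition3p4:
  fixes A :: "('m::{t2_space, second_countable_topology}, 'e::euclidean_space) atlas"
    and h :: "'m tensor02"
    and D :: "'m connection"
    and Ds :: "'m gsec \<Rightarrow> 'm gsec \<Rightarrow> 'm gsec"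
  assumes "quasi_statistical A h D"
    and "symmetric02 A h \<or> skew02 A h"
  shows "is_gen_dual A h D Ds \<longleftrightarrow>
    (\<forall>X\<in>vector_fields A. \<forall>Z\<in>vector_fields A. \<forall>\<alpha>\<in>one_forms A. \<forall>\<gamma>\<in>one_forms A.
       Ds (X, \<alpha>) (Z, \<gamma>) = (sharp A h (cov_form A D X (flat h Z)), cov_form A D X \<gamma>))"
proof -
  have A: "smooth_manifold A" and h: "h \<in> tensor_fields02 A" "nondegenerate A h" and D: "affine_connection A D"
    using assms(1) by (simp_all only: quasi_statistical_def)
  interpret smooth_manifold A by (rule A)
  let ?F = "\<lambda>X Z \<gamma>. (sharp A h (cov_form A D X (flat h Z)), cov_form A D X \<gamma>)"
  note identity = gen_dual_identity[OF h assms(2) D]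
  have F1: "sharp A h (cov_form A D X (flat h Z)) \<in> vector_fields A"
    if "X \<in> vector_fields A" "Z \<in> vector_fields A" for X Z
    by (rule sharp(1)[OF h cov_form(1)[OF D that(1) flat_one_form[OF h(1) that(2)]]])
  show ?thesis
  proof
    assume dual: "is_gen_dual A h D Ds"
    show "\<forall>X\<in>vector_fields A. \<forall>Z\<in>vector_fields A. \<forall>\<alpha>\<in>one_forms A. \<forall>\<gamma>\<in>one_forms A.
        Ds (X, \<alpha>) (Z, \<gamma>) = ?F X Z \<gamma>"
    proof (intro ballI)
      fix X Z \<alpha> \<gamma>
      assume X: "X \<in> vector_fields A" and Z: "Z \<in> vector_fields A"
        and \<alpha>: "\<alpha> \<in> one_forms A" and \<gamma>: "\<gamma> \<in> one_forms A"
      obtain Z' \<gamma>' where Ds: "Ds (X, \<alpha>) (Z, \<gamma>) = (Z', \<gamma>')" by (rule prod.exhaust)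
      \<comment> \<open>Nondegeneracy compares only genuine sections, so the values of
        \<open>Ds\<close> must first be known to be smooth.\<close>
      have "Ds (X, \<alpha>) (Z, \<gamma>) \<in> gen_sections A"
        using dual X Z \<alpha> \<gamma> unfolding is_gen_dual_def gen_sections_def by blast
      then have mem: "Z' \<in> vector_fields A" "\<gamma>' \<in> one_forms A" unfolding Ds gen_sections_def by auto
      have "Z' = sharp A h (cov_form A D X (flat h Z)) \<and> \<gamma>' = cov_form A D X \<gamma>"
      proof (rule hat_h_nondegenerate[OF h assms(2) mem(1) F1[OF X Z] mem(2) cov_form(1)[OF D X \<gamma>]])
        fix Y \<beta> p assume Y: "Y \<in> vector_fields A" and \<beta>: "\<beta> \<in> one_forms A"
        have "hat_h A h (Y, \<beta>) (Ds (X, \<alpha>) (Z, \<gamma>)) p =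
            deriv_along X (hat_h A h (Y, \<beta>) (Z, \<gamma>)) p - hat_h A h (hat_nabla A h D (X, \<alpha>) (Y, \<beta>)) (Z, \<gamma>) p"
          using dual X Y Z \<alpha> \<beta> \<gamma> unfolding is_gen_dual_def by blast
        also have "\<dots> = hat_h A h (Y, \<beta>) (?F X Z \<gamma>) p"
          by (rule identity[OF X Y Z \<beta> \<gamma>, symmetric])
        finally show "hat_h A h (Y, \<beta>) (Z', \<gamma>') p = hat_h A h (Y, \<beta>) (?F X Z \<gamma>) p"
          unfolding Ds .
      qed
      then show "Ds (X, \<alpha>) (Z, \<gamma>) = ?F X Z \<gamma>" unfolding Ds by simp
    qed
  next
    assume eq: "\<forall>X\<in>vector_fields A. \<forall>Z\<in>vector_fields A. \<forall>\<alpha>\<in>one_forms A. \<forall>\<gamma>\<in>one_forms A.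
        Ds (X, \<alpha>) (Z, \<gamma>) = ?F X Z \<gamma>"
    show "is_gen_dual A h D Ds"
      unfolding is_gen_dual_def
    proof (intro conjI ballI allI)
      fix \<sigma> \<tau> assume "\<sigma> \<in> gen_sections A" "\<tau> \<in> gen_sections A"
      then obtain X \<alpha> Z \<gamma> where "\<sigma> = (X, \<alpha>)" "\<tau> = (Z, \<gamma>)" "X \<in> vector_fields A" "Z \<in> vector_fields A"
        "\<alpha> \<in> one_forms A" "\<gamma> \<in> one_forms A" unfolding gen_sections_def by blast
      then show "Ds \<sigma> \<tau> \<in> gen_sections A"
        using eq F1 cov_form(1)[OF D] unfolding gen_sections_def by simp
    next
      fix X Y Z \<alpha> \<beta> \<gamma> p
      assume X: "X \<in> vector_fields A" and Y: "Y \<in> vector_fields A" and Z: "Z \<in> vector_fields A"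
        and \<alpha>: "\<alpha> \<in> one_forms A" and \<beta>: "\<beta> \<in> one_forms A" and \<gamma>: "\<gamma> \<in> one_forms A"
      have "Ds (X, \<alpha>) (Z, \<gamma>) = ?F X Z \<gamma>" using eq X Z \<alpha> \<gamma> by blast
      then show "hat_h A h (Y, \<beta>) (Ds (X, \<alpha>) (Z, \<gamma>)) p =
          deriv_along X (hat_h A h (Y, \<beta>) (Z, \<gamma>)) p - hat_h A h (hat_nabla A h D (X, \<alpha>) (Y, \<beta>)) (Z, \<gamma>) p"
        using identity[OF X Y Z \<beta> \<gamma>] by simp
    qed
  qed
qed

end
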